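(* Consider the geometric model and suppose that $\overline{\alpha}=\overline{\beta}=1$. Then the shape function $g$ satisfies $$g(s,t)=s\,E\left[\frac{a}{1-a}\right]+t\,E\left[\frac{b}{1-b}\right]\quad\text{for all } s,t>0$$ (an identity in $[0,\infty]$).
   Context: $\mathbb{N}=\{1,2,\dots\}$, $\mathbb{Z}_+=\{0,1,2,\dots\}$, $\mathbb{R}_+=[0,\infty)$; $\lfloor x\rfloor$ is the integer part; $x\vee y=\max\{x,y\}$. Environment. Let $\mathbf{a}=(a_n)_{n\in\mathbb{N}}$ and $\mathbf{b}=(b_n)_{n\in\mathbb{N}}$ be stationary random sequences in $(0,1)$, and let $\mu$ be the distribution of $(\mathbf{a},\mathbf{b})$. For $k\in\mathbb{Z}_+$ let $\tau_k$ be the shift $(c_n)_{n\in\mathbb{N}}\mapsto(c_{n+k})_{n\in\mathbb{N}}$. It is assumed that $\mu$ is (stationary and) ergodic under the map $\tau_k\times\tau_l:(\mathbf{a},\mathbf{b})\mapsto(\tau_k\mathbf{a},\tau_l\mathbf{b})$ for each $k,l\in\mathbb{N}$. Write $E$ for expectation under $\mu$, $a=a_1$, $b=b_1$, and let $\alpha,\beta$ be the distributions of $a,b$. For a Borel measure $\eta$ on $\mathbb{R}$, $\overline{\eta}$ is the right endpoint of the support of $\eta$. Geometric model. Given $(\mathbf{a},\mathbf{b})$, the weights $W(i,j)$, $i,j\in\mathbb{N}$, are (conditionally) independent and $W(i,j)$ is geometric with parameter $a_ib_j$, i.e. $\mathbf{P}_{\mathbf{a},\mathbf{b}}(W(i,j)\ge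 k)=a_i^kb_j^k$ for $k\in\mathbb{Z}_+$ (values in $\mathbb{Z}_+$). Here $\mathbf{P}_{\mathbf{a},\mathbf{b}}$ is the conditional joint law (a product measure on $\mathbb{R}_+^{\mathbb{N}^2}$), and $\mathbb{P}(\cdot)=\int\mathbf{P}_{\mathbf{a},\mathbf{b}}(\cdot)\,\mu(d\mathbf{a},d\mathbf{b})$ is the joint law of the weights. Last-passage times. $G(i,j)=G(i-1,j)\vee G(i,j-1)+W(i,j)$ for $i,j\in\mathbb{N}$, with $G(i,0)=G(0,j)=0$. Equivalently, $G(m,n)$ is the maximum over all directed paths $\pi$ from $(1,1)$ to $(m,n)$ with steps $(1,0)$ or $(0,1)$ of $\sum_{(i,j)\in\pi}W(i,j)$. Shape function. There is a deterministic function $g:(0,\infty)^2\to[0,\infty]$, called the shape function, such that $\mathbb{P}$-a.s. $\lim_{n\to\infty}G(\lfloor ns\rfloor,\lfloor nt\rfloor)/n=g(s,t)$ for all $s,t>0$. *)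

theory Defs
  imports "HOL-Probability.Probability"
begin

section \<open>The environment\<close>

text \<open>Sequences are indexed by \<open>{1..}\<close>, so (as always with \<open>PiM\<close>) they are functions that are
  \<open>undefined\<close> at \<open>0\<close>.\<close>

abbreviation unit_seqs :: "(nat \<Rightarrow> real) measure" where
  "unit_seqs \<equiv> PiM {1..} (\<lambda>_. restrict_space borel {0<..<1})"

definition shift :: "nat \<Rightarrow> (nat \<Rightarrow> real) \<Rightarrow> (nat \<Rightarrow> real)" where
  "shift k c = (\<lambda>n\<in>{1..}. c (n + k))"

definition measure_preserving :: "'a measure \<Rightarrow> ('a \<Rightarrow> 'a) \<Rightarrow> bool" where
  "measure_preserving M T \<longleftrightarrow> T \<in> M \<rightarrow>\<^sub>M M \<and> distr M M T = M"

definition ergodic :: "'a measure \<Rightarrow> ('a \<Rightarrow> 'a) \<Rightarrow> bool" where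
  "ergodic M T \<longleftrightarrow> measure_preserving M T \<and>
     (\<forall>A\<in>sets M. T -` A \<inter> space M = A \<longrightarrow> emeasure M A = 0 \<or> emeasure M (space M - A) = 0)"

text \<open>The law \<open>\<mu>\<close> of the pair of parameter sequences. The two marginal conditions also follow
  from the invariance of \<open>\<mu>\<close> under the product shifts.\<close>

definition environment :: "((nat \<Rightarrow> real) \<times> (nat \<Rightarrow> real)) measure \<Rightarrow> bool" where
  "environment \<mu> \<longleftrightarrow>
     prob_space \<mu> \<and> sets \<mu> = sets (unit_seqs \<Otimes>\<^sub>M unit_seqs) \<and>
     measure_preserving (distr \<mu> unit_seqs fst) (shift 1) \<and>
     measure_preserving (distr \<mu> unit_seqs snd) (shift 1) \<and>
     (\<forall>k\<ge>1. \<forall>l\<ge>1. ergodic \<mu> (map_prod (shift k) (shift l)))"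

definition law_a :: "((nat \<Rightarrow> real) \<times> (nat \<Rightarrow> real)) measure \<Rightarrow> real measure" where
  "law_a \<mu> = distr \<mu> borel (\<lambda>(a, b). a 1)"

definition law_b :: "((nat \<Rightarrow> real) \<times> (nat \<Rightarrow> real)) measure \<Rightarrow> real measure" where
  "law_b \<mu> = distr \<mu> borel (\<lambda>(a, b). b 1)"

definition support :: "real measure \<Rightarrow> real set" where
  "support \<eta> = {x. \<forall>U. open U \<and> x \<in> U \<longrightarrow> emeasure \<eta> U > 0}"

definition right_endpoint :: "real measure \<Rightarrow> ereal" where
  "right_endpoint \<eta> = (SUP x\<in>support \<eta>. ereal x)"


section \<open>Geometric weights\<close>

text \<open>The geometric distribution with parameter \<open>q\<close>, given by \<open>P(W \<ge> k) = q ^ k\<close>;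
  the library's \<open>geometric_pmf\<close> is parametrised by the success probability \<open>1 - q\<close>.\<close>

definition geometric_law :: "real \<Rightarrow> real measure" where
  "geometric_law q = distr (measure_pmf (geometric_pmf (1 - q))) (restrict_space borel {0..}) real"

text \<open>The quenched law of the weights; the weight \<open>W(i,j)\<close> is the coordinate \<open>w (i, j)\<close>.\<close>

definition quenched_law ::
    "(nat \<Rightarrow> real) \<Rightarrow> (nat \<Rightarrow> real) \<Rightarrow> (nat \<times> nat \<Rightarrow> real) measure" where
  "quenched_law a b = PiM ({1..} \<times> {1..}) (\<lambda>(i, j). geometric_law (a i * b j))"

definition annealed_law ::
    "((nat \<Rightarrow> real) \<times> (nat \<Rightarrow> real)) measure \<Rightarrow> (nat \<times> nat \<Rightarrow> real) measure" where
  "annealed_law \<mu> = \<mu> \<bind> (\<lambda>(a, b). quenched_law a b)"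


section \<open>Last-passage times and the shape function\<close>

fun last_passage :: "(nat \<times> nat \<Rightarrow> real) \<Rightarrow> nat \<Rightarrow> nat \<Rightarrow> real" where
  "last_passage w 0 j = 0"
| "last_passage w i 0 = 0"
| "last_passage w (Suc i) (Suc j) =
     max (last_passage w i (Suc j)) (last_passage w (Suc i) j) + w (Suc i, Suc j)"

text \<open>Values of \<open>g\<close> outside the open quadrant are irrelevant. Since the weights live on
  \<open>{0..}\<close>, the coercion \<open>ennreal\<close> does not truncate.\<close>

definition shape_function ::
    "((nat \<Rightarrow> real) \<times> (nat \<Rightarrow> real)) measure \<Rightarrow> (real \<Rightarrow> real \<Rightarrow> ennreal) \<Rightarrow> bool" where
  "shape_function \<mu> g \<longleftrightarrow>
     (AE w in annealed_law \<mu>. \<forall>s>0. \<forall>t>0.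
        (\<lambda>n. ennreal (last_passage w (nat \<lfloor>real n * s\<rfloor>) (nat \<lfloor>real n * t\<rfloor>) / real n))
          \<longlonglongrightarrow> g s t)"


section \<open>The laws are as intended\<close>

lemma geometric_law_tail:
  assumes "0 < q" "q < 1"
  shows "measure (geometric_law q) {real k..} = q ^ k"
proof -
  have m: "{real k..} \<in> sets (restrict_space borel {0..})"
    by (auto simp: sets_restrict_space image_iff intro!: bexI[of _ "{real k..}"])
  have f: "real \<in> measure_pmf (geometric_pmf (1 - q)) \<rightarrow>\<^sub>M restrict_space borel {0..}"
    by (auto simp: measurable_restrict_space2_iff)
  have "measure (geometric_law q) {real k..} = measure_pmf.prob (geometric_pmf (1 - q)) {k..}"
    unfolding geometric_law_def
    by (subst measure_distr[OF f m]) (auto intro!: arg_cong[where f = "measure _"])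
  also have "{k..} = - {..<k}" by auto
  also have "measure_pmf.prob (geometric_pmf (1 - q)) (- {..<k})
      = 1 - measure_pmf.prob (geometric_pmf (1 - q)) {..<k}"
    using measure_pmf.prob_compl[of "{..<k}" "geometric_pmf (1 - q)"] by (simp add: Compl_eq_Diff_UNIV)
  also have "measure_pmf.prob (geometric_pmf (1 - q)) {..<k} = (\<Sum>n<k. q ^ n * (1 - q))"
    using assms by (subst measure_measure_pmf_finite) auto
  also have "\<dots> = 1 - q ^ k"
    using one_diff_power_eq[of q k] by (simp add: sum_distrib_left mult.commute)
  finally show ?thesis by simp
qed

lemma prob_space_geometric_law: "prob_space (geometric_law q)"
  unfolding geometric_law_def
  by (rule measure_pmf.prob_space_distr) (auto simp: measurable_restrict_space2_iff)

lemma sets_geometric_law [simp, measurable_cong]: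
  "sets (geometric_law q) = sets (restrict_space borel {0..})"
  by (simp add: geometric_law_def)

lemma sets_quenched_law:
  "sets (quenched_law a b) = sets (PiM ({1..} \<times> {1..}) (\<lambda>_. restrict_space borel {0..}))"
  unfolding quenched_law_def by (rule sets_PiM_cong) auto

lemma prob_space_quenched_law: "prob_space (quenched_law a b)"
  unfolding quenched_law_def
  by (rule prob_space_PiM) (auto simp: prob_space_geometric_law split: prod.splits)

lemma measurable_geometric_law:
  assumes A: "A \<in> sets (restrict_space borel {0..})"
  shows "(\<lambda>q. emeasure (geometric_law q) A) \<in> borel_measurable (restrict_space borel {0<..<1})"
proof -
  have f: "real \<in> measure_pmf p \<rightarrow>\<^sub>M restrict_space borel {0..}" for p
    by (auto simp: measurable_restrict_space2_iff)
  have "emeasure (geometric_law q) A = (\<Sum>n. ennreal (q ^ n * (1 - q)) * indicator (real -` A) n)"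
    if "q \<in> {0<..<1}" for q
  proof -
    have "emeasure (geometric_law q) A = emeasure (measure_pmf (geometric_pmf (1 - q))) (real -` A)"
      unfolding geometric_law_def by (subst emeasure_distr[OF f A]) simp
    also have "\<dots> = (\<integral>\<^sup>+n. indicator (real -` A) n \<partial>measure_pmf (geometric_pmf (1 - q)))"
      by simp
    also have "\<dots> = (\<Sum>n. ennreal (q ^ n * (1 - q)) * indicator (real -` A) n)"
      using that by (subst nn_integral_measure_pmf) (simp add: nn_integral_count_space_nat)
    finally show ?thesis .
  qed
  moreover have "(\<lambda>q. \<Sum>n. ennreal (q ^ n * (1 - q)) * indicator (real -` A) n)
      \<in> borel_measurable (restrict_space borel {0<..<1::real})"
    by (rule measurable_restrict_space1) measurable
  ultimately show ?thesis
    by (subst measurable_cong) (auto simp: space_restrict_space)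
qed

lemma measurable_quenched_law:
  "(\<lambda>(a, b). quenched_law a b)
     \<in> (unit_seqs \<Otimes>\<^sub>M unit_seqs) \<rightarrow>\<^sub>M prob_algebra (PiM ({1..} \<times> {1..}) (\<lambda>_. restrict_space borel {0..}))"
proof (rule measurable_prob_algebra_generated[OF sets_PiM Int_stable_prod_algebra prod_algebra_sets_into_space])
  fix A :: "(nat \<times> nat \<Rightarrow> real) set"
  assume "A \<in> prod_algebra ({1..} \<times> {1..}) (\<lambda>_. restrict_space borel {0..})"
  then obtain J E where A: "A = prod_emb ({1..} \<times> {1..}) (\<lambda>_. restrict_space borel {0..}) J (\<Pi>\<^sub>E j\<in>J. E j)"
    and J: "finite J" "J \<subseteq> {1..} \<times> {1..}"
    and E: "\<And>i. i \<in> J \<Longrightarrow> E i \<in> sets (restrict_space borel {0..})"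
    by (rule prod_algebraE) blast
  have "emeasure (quenched_law a b) A = (\<Prod>(i, j)\<in>J. emeasure (geometric_law (a i * b j)) (E (i, j)))" for a b
  proof -
    have "A = prod_emb ({1..} \<times> {1..}) (\<lambda>(i, j). geometric_law (a i * b j)) J (\<Pi>\<^sub>E j\<in>J. E j)"
      unfolding A prod_emb_def
      by (intro arg_cong2[where f = "(\<inter>)"] refl PiE_cong) (auto simp: geometric_law_def)
    then have "emeasure (quenched_law a b) A
        = (\<Prod>i\<in>J. emeasure (case i of (i, j) \<Rightarrow> geometric_law (a i * b j)) (E i))"
      unfolding quenched_law_def using J E
      by (auto intro!: emeasure_PiM_emb simp: prob_space_geometric_law split: prod.splits)
    then show ?thesis by (simp add: case_prod_unfold)
  qed
  moreover have "(\<lambda>x. emeasure (geometric_law (fst x i * snd x j)) (E (i, j)))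
      \<in> borel_measurable (unit_seqs \<Otimes>\<^sub>M unit_seqs)" if "(i, j) \<in> J" for i j
  proof (rule measurable_compose[OF _ measurable_geometric_law[OF E[OF that]]])
    have ij: "i \<in> {1..}" "j \<in> {1..}" using that J by auto
    have "(\<lambda>c. c k) \<in> unit_seqs \<rightarrow>\<^sub>M borel" if "k \<in> {1..}" for k
      using measurable_component_singleton[OF that, of "\<lambda>_. restrict_space borel {0<..<1::real}"]
      by (simp add: measurable_restrict_space2_iff)
    note c = this[OF ij(1)] this[OF ij(2)]
    have "(\<lambda>x. fst x i * snd x j) \<in> borel_measurable (unit_seqs \<Otimes>\<^sub>M unit_seqs)"
      by (intro borel_measurable_times measurable_compose[OF measurable_fst c(1)]
          measurable_compose[OF measurable_snd c(2)])
    moreover have "fst x i * snd x j \<in> {0<..<1}" if "x \<in> space (unit_seqs \<Otimes>\<^sub>M unit_seqs)" for x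
    proof -
      have "fst x i \<in> {0<..<1}" "snd x j \<in> {0<..<1}"
        using that ij by (auto simp: space_pair_measure space_PiM space_restrict_space)
      then show ?thesis
        using mult_strict_mono[of "fst x i" 1 "snd x j" 1] by auto
    qed
    ultimately show "(\<lambda>x. fst x i * snd x j)
        \<in> (unit_seqs \<Otimes>\<^sub>M unit_seqs) \<rightarrow>\<^sub>M restrict_space borel {0<..<1}"
      by (auto simp: measurable_restrict_space2_iff)
  qed
  ultimately show "(\<lambda>x. emeasure (case x of (a, b) \<Rightarrow> quenched_law a b) A)
      \<in> borel_measurable (unit_seqs \<Otimes>\<^sub>M unit_seqs)"
    by (auto simp: case_prod_unfold intro!: borel_measurable_prod_ennreal)
qed (auto simp: prob_space_quenched_law sets_quenched_law)

lemma emeasure_annealed_law: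
  assumes \<mu>: "environment \<mu>"
    and A: "A \<in> sets (PiM ({1..} \<times> {1..}) (\<lambda>_. restrict_space borel {0..}))"
  shows "emeasure (annealed_law \<mu>) A = (\<integral>\<^sup>+(a, b). emeasure (quenched_law a b) A \<partial>\<mu>)"
proof -
  interpret prob_space \<mu> using \<mu> by (simp add: environment_def)
  have "sets \<mu> = sets (unit_seqs \<Otimes>\<^sub>M unit_seqs)" using \<mu> by (simp add: environment_def)
  then have "(\<lambda>(a, b). quenched_law a b)
      \<in> \<mu> \<rightarrow>\<^sub>M prob_algebra (PiM ({1..} \<times> {1..}) (\<lambda>_. restrict_space borel {0..}))"
    using measurable_quenched_law by (simp cong: measurable_cong_sets)
  from emeasure_bind[OF not_empty measurable_prob_algebraD[OF this] A] show ?thesis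
    by (simp add: annealed_law_def case_prod_unfold)
qed

end

theory Submission
  imports Defs
begin

text \<open>Write \<open>A = E[a/(1-a)]\<close> and \<open>B = E[b/(1-b)]\<close>; the claim is \<open>g(s,t) = sA + tB\<close>.

  The upper bound comes from a comparison with a stationary model. Put independent geometric weights
  with parameters \<open>a\<^sub>i\<close> on the horizontal axis and \<open>b\<^sub>j\<close> on the vertical axis. The map that turns the
  increments on the lower and left side of a unit square, together with the weight of the square, into
  the increments on its upper and right side preserves the product of the two geometric laws
  (\<open>corner_map_geometric\<close>, a discrete Burke property). So every horizontal increment in column \<open>i\<close> stays
  geometric with parameter \<open>a\<^sub>i\<close> (\<open>row_law_hor\<close>). The passage times with boundary dominate those
  without, and at \<open>(m,n)\<close> they are a sum of \<open>m\<close> horizontal increments on the top row and \<open>n\<close> boundary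
  weights; hence the quenched mean of \<open>G(m,n)\<close> is at most the sum of the
  \<open>a\<^sub>i/(1-a\<^sub>i)\<close> and the \<open>b\<^sub>j/(1-b\<^sub>j)\<close> (\<open>nn_integral_last_passage_le\<close>). Averaging over the
  environment and Fatou's lemma give \<open>g(s,t) \<le> sA + tB\<close> (\<open>shape_le\<close>).

  For the lower bound, a path may run along the first row only. On the event \<open>b\<^sub>1 > c\<close>, the weights there
  are stochastically larger than geometric ones with parameters \<open>a\<^sub>i c\<close>, and by ergodicity the averages of
  their means have an upper limit of at least \<open>E[ac/(1-ac)]\<close>. Since the right endpoint of the law of \<open>b\<close> is \<open>1\<close>, this event has
  positive probability for every \<open>c < 1\<close>, and as \<open>g\<close> is deterministic we get \<open>g(s,t) \<ge> sA\<close>; symmetrically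
  \<open>g(s,t) \<ge> tB\<close> (\<open>shape_ge_line\<close>). Because \<open>G(\<lfloor>ns\<rfloor>,\<lfloor>nt\<rfloor>)/n\<close> is known to converge, upper limits suffice here.
  They obey a reversed Fatou inequality for bounded variables, which replaces both the law of large
  numbers for the weights and the pointwise ergodic theorem for the environment: an upper limit of averages is shift
  invariant, hence constant by ergodicity, and its mean is at least the limit of the means
  (\<open>limsup_average_ge\<close>).

  Finally \<open>g\<close> is superadditive, since the annealed law of the weights is invariant under shifts
  (\<open>shape_superadditive\<close>). Splitting \<open>(s,t)\<close> into \<open>(cs, (1-c)t)\<close> and \<open>((1-c)s, ct)\<close> and using the
  row bound for the first part and the column bound for the second gives \<open>g(s,t) \<ge> c(sA + tB)\<close> for all
  \<open>c < 1\<close> (\<open>shape_ge\<close>).\<close>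

section \<open>Deterministic properties of last-passage times\<close>

lemma last_passage_0_right [simp]: "last_passage w i 0 = 0"
  by (cases i) auto

lemma last_passage_cong:
  "(\<And>k l. 1 \<le> k \<Longrightarrow> k \<le> i \<Longrightarrow> 1 \<le> l \<Longrightarrow> l \<le> j \<Longrightarrow> w (k, l) = w' (k, l)) \<Longrightarrow>
    last_passage w i j = last_passage w' i j"
  by (induction w i j rule: last_passage.induct) auto

abbreviation shift_weights :: "nat \<Rightarrow> nat \<Rightarrow> (nat \<times> nat \<Rightarrow> real) \<Rightarrow> (nat \<times> nat \<Rightarrow> real)" where
  "shift_weights m n w \<equiv> (\<lambda>x\<in>{1..} \<times> {1..}. w (fst x + m, snd x + n))"

lemma last_passage_nonneg:
  "\<forall>i\<ge>1. \<forall>j\<ge>1. 0 \<le> w (i, j) \<Longrightarrow> 0 \<le> last_passage w m n"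
proof (induction w m n rule: last_passage.induct)
  case (3 w i j)
  then show ?case by (simp add: le_max_iff_disj)
qed auto

lemma last_passage_mono:
  assumes w: "\<forall>i\<ge>1. \<forall>j\<ge>1. 0 \<le> w (i, j)" and "m \<le> m'" "n \<le> n'"
  shows "last_passage w m n \<le> last_passage w m' n'"
proof -
  have "last_passage w i n \<le> last_passage w (Suc i) n" for i
    using w by (cases n) (auto intro!: add_increasing2)
  then have "last_passage w m n \<le> last_passage w m' n"
    using \<open>m \<le> m'\<close> by (rule lift_Suc_mono_le)
  also have "last_passage w m' j \<le> last_passage w m' (Suc j)" for j
    using w by (cases m') (auto intro!: add_increasing2)
  then have "last_passage w m' n \<le> last_passage w m' n'"
    using \<open>n \<le> n'\<close> by (rule lift_Suc_mono_le)
  finally show ?thesis .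
qed

text \<open>A path to \<open>(m,n)\<close> can be continued, from \<open>(m+1,n+1)\<close> on, by a path in the shifted weights; the
  unit corner in between is skipped, which costs nothing for nonnegative weights.\<close>

lemma last_passage_superadditive:
  assumes w: "\<forall>i\<ge>1. \<forall>j\<ge>1. 0 \<le> w (i, j)"
  shows "last_passage w m n + last_passage (shift_weights m n w) k l \<le> last_passage w (m + k) (n + l)"
proof (induction "k + l" arbitrary: k l rule: less_induct)
  case less
  show ?case
  proof (cases "k = 0 \<or> l = 0")
    case True
    then show ?thesis using last_passage_mono[OF w, of m "m + k" n "n + l"] by auto
  next
    case False
    then obtain k' l' where kl: "k = Suc k'" "l = Suc l'" by (auto simp: gr0_conv_Suc)
    then show ?thesis
      using less[of k' l] less[of k l'] by (auto simp: max_def add_ac)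
  qed
qed

lemma sum_row_le_last_passage:
  assumes w: "\<forall>i\<ge>1. \<forall>j\<ge>1. 0 \<le> w (i, j)" and "1 \<le> n"
  shows "(\<Sum>i<m. w (Suc i, 1)) \<le> last_passage w m n"
proof -
  have "(\<Sum>i<m. w (Suc i, 1)) \<le> last_passage w m 1"
    by (induction m) auto
  also have "\<dots> \<le> last_passage w m n" by (rule last_passage_mono[OF w]) (use assms in auto)
  finally show ?thesis .
qed

lemma sum_column_le_last_passage:
  assumes w: "\<forall>i\<ge>1. \<forall>j\<ge>1. 0 \<le> w (i, j)" and "1 \<le> m"
  shows "(\<Sum>j<n. w (1, Suc j)) \<le> last_passage w m n"
proof -
  have "(\<Sum>j<n. w (1, Suc j)) \<le> last_passage w 1 n"
    by (induction n) auto
  also have "\<dots> \<le> last_passage w m n" by (rule last_passage_mono[OF w]) (use assms in auto)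
  finally show ?thesis .
qed

section \<open>Measurability of the weights\<close>

abbreviation weight_space :: "(nat \<times> nat \<Rightarrow> real) measure" where
  "weight_space \<equiv> PiM ({1..} \<times> {1..}) (\<lambda>_. restrict_space borel {0..})"

lemma weight_space_nonneg:
  "w \<in> space weight_space \<Longrightarrow> \<forall>i\<ge>1. \<forall>j\<ge>1. 0 \<le> w (i, j)"
  by (auto simp: space_PiM space_restrict_space PiE_iff)

lemma measurable_weight [measurable]:
  assumes "1 \<le> i" "1 \<le> j"
  shows "(\<lambda>w. w (i, j)) \<in> borel_measurable weight_space"
  using measurable_component_singleton[of "(i, j)" "{1..} \<times> {1..}" "\<lambda>_. restrict_space borel {0::real..}"] assms
  by (auto simp: measurable_restrict_space2_iff)

lemma measurable_last_passage [measurable]: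
  "(\<lambda>w. last_passage w i j) \<in> borel_measurable weight_space"
proof (induction "i + j" arbitrary: i j rule: less_induct)
  case less
  show ?case
  proof (cases i)
    case 0 then show ?thesis by simp
  next
    case i: (Suc i')
    show ?thesis
    proof (cases j)
      case 0 then show ?thesis by simp
    next
      case (Suc j')
      show ?thesis unfolding i Suc last_passage.simps
        by (intro borel_measurable_add borel_measurable_max measurable_weight less) (auto simp: i Suc)
    qed
  qed
qed

section \<open>Reversibility of a corner with geometric increments\<close>

abbreviation geo :: "real \<Rightarrow> nat pmf" where "geo q \<equiv> geometric_pmf (1 - q)"

text \<open>Here \<open>x\<close> and \<open>y\<close> are the increments of the passage time along the lower and the left side of
  a unit square and \<open>w\<close> is its weight; the truncated differences are the positive parts of \<open>x - y\<close> and
  \<open>y - x\<close>. The reason for the invariance is that for independent geometric \<open>x\<close> and \<open>y\<close> the minimum is independent of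
  the difference and geometric with parameter \<open>a * b\<close>. The map replaces the minimum by the independent
  copy \<open>w\<close> and keeps the difference, so the law of the pair does not change. In the
  computation, the fibre over \<open>(k, l)\<close> is parametrised by the discarded minimum.\<close>

lemma corner_map_geometric:
  assumes a: "0 < a" "a < 1" and b: "0 < b" "b < 1"
  shows "map_pmf (\<lambda>((x, y), w). (w + (x - y), w + (y - x))) (pair_pmf (pair_pmf (geo a) (geo b)) (geo (a * b)))
       = pair_pmf (geo a) (geo b)" (is "map_pmf ?f ?p = _")
proof (rule pmf_eqI)
  fix kl :: "nat \<times> nat"
  obtain k l where kl: "kl = (k, l)" by (cases kl)
  define c where "c = min k l"
  have ab: "0 < a * b" "a * b < 1" using a b by (auto intro: mult_strict_mono[of a 1 b 1, simplified])
  define h where "h r = ((r + (k - c), r + (l - c)), c)" for r :: nat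
  have "inj h" by (auto simp: inj_def h_def)
  have vim: "?f -` {(k, l)} = range h"
  proof (intro equalityI subsetI)
    fix z assume "z \<in> ?f -` {(k, l)}"
    moreover obtain x y w where z: "z = ((x, y), w)" by (metis surj_pair)
    ultimately have *: "w + (x - y) = k" "w + (y - x) = l" by auto
    then have "w = c" "x = min x y + (k - c)" "y = min x y + (l - c)" unfolding c_def by auto
    then have "z = h (min x y)" unfolding z h_def by (metis)
    then show "z \<in> range h" by blast
  next
    fix z assume "z \<in> range h" then show "z \<in> ?f -` {(k, l)}" by (auto simp: h_def c_def)
  qed
  have "ennreal (pmf (map_pmf ?f ?p) kl) = emeasure ?p (range h)"
    unfolding kl by (simp add: pmf_map vim measure_pmf.emeasure_eq_measure)
  also have "\<dots> = (\<integral>\<^sup>+r. ennreal (pmf ?p (h r)) \<partial>count_space UNIV)"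
    by (rule nn_integral_pmf'[OF \<open>inj h\<close>, symmetric])
  also have "\<dots> = (\<Sum>r. ennreal (pmf ?p (h r)))"
    by (rule nn_integral_count_space_nat)
  also have "\<dots> = ennreal (a ^ k * (1 - a) * (b ^ l * (1 - b)))"
  proof (rule suminf_ennreal_eq)
    have "(\<lambda>r. (a * b) ^ r) sums (1 / (1 - a * b))" using ab by (intro geometric_sums) auto
    then have "(\<lambda>r. (a ^ k * (1 - a) * (b ^ l * (1 - b)) * (1 - a * b)) * (a * b) ^ r)
        sums ((a ^ k * (1 - a) * (b ^ l * (1 - b)) * (1 - a * b)) * (1 / (1 - a * b)))"
      by (rule sums_mult)
    moreover have "a ^ k = a ^ c * a ^ (k - c)" "b ^ l = b ^ c * b ^ (l - c)"
      by (simp_all add: c_def flip: power_add)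
    ultimately show "(\<lambda>r. pmf ?p (h r)) sums (a ^ k * (1 - a) * (b ^ l * (1 - b)))"
      using a b ab by (simp add: h_def pmf_pair power_add power_mult_distrib mult_ac)
  qed (rule pmf_nonneg)
  finally show "pmf (map_pmf ?f ?p) kl = pmf (pair_pmf (geo a) (geo b)) kl"
    using a b by (simp add: kl pmf_pair)
qed

lemma corner_bind_geometric:
  assumes "0 < a" "a < 1" and "0 < b" "b < 1"
  shows "do {x \<leftarrow> geo a; y \<leftarrow> geo b; w \<leftarrow> geo (a * b); K (w + (x - y)) (w + (y - x))}
       = do {x \<leftarrow> geo a; y \<leftarrow> geo b; K x y}"
proof -
  have "bind_pmf (map_pmf (\<lambda>((x, y), w). (w + (x - y), w + (y - x)))
      (pair_pmf (pair_pmf (geo a) (geo b)) (geo (a * b)))) (\<lambda>(x, y). K x y)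
    = bind_pmf (pair_pmf (geo a) (geo b)) (\<lambda>(x, y). K x y)"
    by (simp only: corner_map_geometric[OF assms])
  then show ?thesis
    by (simp add: map_pmf_def pair_pmf_def bind_assoc_pmf bind_return_pmf)
qed

text \<open>The increments of the passage times \<open>H(i,j)\<close> with boundary weights \<open>w (i, 0)\<close> and \<open>w (0, j)\<close>:
  \<open>hor w i j = H(i,j) - H(i-1,j)\<close> and \<open>ver w i j = H(i,j) - H(i,j-1)\<close>. Working with increments instead of \<open>H\<close>
  makes each step an application of the corner map. Undefined increments to the left of column \<open>0\<close> or below row
  \<open>0\<close> are set to \<open>0\<close>.\<close>

function (sequential) hor :: "(nat \<times> nat \<Rightarrow> nat) \<Rightarrow> nat \<Rightarrow> nat \<Rightarrow> nat"
  and ver :: "(nat \<times> nat \<Rightarrow> nat) \<Rightarrow> nat \<Rightarrow> nat \<Rightarrow> nat" where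
  "hor w 0 j = 0"
| "hor w i 0 = w (i, 0)"
| "hor w (Suc i) (Suc j) = w (Suc i, Suc j) + (hor w (Suc i) j - ver w i (Suc j))"
| "ver w i 0 = 0"
| "ver w 0 j = w (0, j)"
| "ver w (Suc i) (Suc j) = w (Suc i, Suc j) + (ver w i (Suc j) - hor w (Suc i) j)"
  by pat_completeness auto
termination by (relation "Wellfounded.measure (\<lambda>x. case x of Inl (w, i, j) \<Rightarrow> i + j | Inr (w, i, j) \<Rightarrow> i + j)") auto

lemma hor_ver_cong:
  "(\<And>k l. k \<le> i \<Longrightarrow> l \<le> j \<Longrightarrow> w (k, l) = w' (k, l)) \<Longrightarrow> hor w i j = hor w' i j"
  "(\<And>k l. k \<le> i \<Longrightarrow> l \<le> j \<Longrightarrow> w (k, l) = w' (k, l)) \<Longrightarrow> ver w i j = ver w' i j"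
  by (induction w i j and w i j rule: hor_ver.induct) simp_all

text \<open>The horizontal increments along the staircase that runs in row \<open>j + 1\<close> up to column \<open>i\<close> and in row
  \<open>j\<close> from there to column \<open>m\<close>. Together with the vertical increment \<open>ver w i (Suc j)\<close> at its step this is
  the whole boundary of the region of weights processed so far.\<close>

definition front :: "nat \<Rightarrow> (nat \<times> nat \<Rightarrow> nat) \<Rightarrow> nat \<Rightarrow> nat \<Rightarrow> nat \<Rightarrow> nat" where
  "front m w i j = (\<lambda>k. if k \<in> {1..m} then hor w k (if k \<le> i then Suc j else j) else 0)"

text \<open>Parameter \<open>1\<close> at index \<open>0\<close> makes \<open>a i * b j\<close> the right parameter also for the boundary
  weights: \<open>a i\<close> on the horizontal and \<open>b j\<close> on the vertical axis.\<close>

locale boundary_params =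
  fixes a b :: "nat \<Rightarrow> real"
  assumes a0: "a 0 = 1" and b0: "b 0 = 1"
    and a: "\<And>i. 1 \<le> i \<Longrightarrow> 0 < a i \<and> a i < 1"
    and b: "\<And>j. 1 \<le> j \<Longrightarrow> 0 < b j \<and> b j < 1"
begin

abbreviation weights :: "(nat \<times> nat) set \<Rightarrow> (nat \<times> nat \<Rightarrow> nat) pmf" where
  "weights A \<equiv> Pi_pmf A 0 (\<lambda>(i, j). geo (a i * b j))"

abbreviation row_law :: "nat \<Rightarrow> (nat \<Rightarrow> nat) pmf" where
  "row_law m \<equiv> Pi_pmf {1..m} 0 (\<lambda>i. geo (a i))"

text \<open>Adding one cell moves the staircase across that cell. The new weight is independent of the increments on the old
  staircase, so the corner map applies and the product law survives; the increments away from the corner are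
  untouched.\<close>

lemma corner_flip:
  assumes "finite A" "Suc i \<le> m" "(Suc i, Suc j) \<notin> A"
    and A: "{0..m} \<times> {0..j} \<union> {0..i} \<times> {Suc j} = A"
    and law: "map_pmf (\<lambda>w. (front m w i j, ver w i (Suc j))) (weights A)
      = pair_pmf (row_law m) (geo (b (Suc j)))"
  shows "map_pmf (\<lambda>w. (front m w (Suc i) j, ver w (Suc i) (Suc j))) (weights (insert (Suc i, Suc j) A))
      = pair_pmf (row_law m) (geo (b (Suc j)))"
proof -
  define st where "st = (\<lambda>(h :: nat \<Rightarrow> nat, v :: nat) y :: nat.
    (h(Suc i := y + (h (Suc i) - v)), y + (v - h (Suc i))))"
  have st: "(front m (w(c := y)) (Suc i) j, ver (w(c := y)) (Suc i) (Suc j))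
      = st (front m w i j, ver w i (Suc j)) y" if c: "c = (Suc i, Suc j)" for w c y
  proof -
    have h: "hor (w((i', j') := y)) k l = hor w k l" if "k < i' \<or> l < j'" for k l i' j'
      using that by (intro hor_ver_cong) auto
    have v: "ver (w((i', j') := y)) k l = ver w k l" if "k < i' \<or> l < j'" for k l i' j'
      using that by (intro hor_ver_cong) auto
    show ?thesis unfolding st_def front_def c using assms(2)
      by (auto simp: fun_eq_iff h v le_Suc_eq)
  qed
  define R where "R = {1..m} - {Suc i}"
  have R: "{1..m} = insert (Suc i) R" "finite R" "Suc i \<notin> R"
    using assms(2) by (auto simp: R_def)
  have "map_pmf (\<lambda>w. (front m w (Suc i) j, ver w (Suc i) (Suc j))) (weights (insert (Suc i, Suc j) A))
    = do {y \<leftarrow> geo (a (Suc i) * b (Suc j)); w \<leftarrow> weights A; return_pmf (st (front m w i j, ver w i (Suc j)) y)}"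
    using assms(1,3) by (simp add: Pi_pmf_insert' map_bind_pmf st del: hor.simps ver.simps)
  also have "\<dots> = do {y \<leftarrow> geo (a (Suc i) * b (Suc j));
      s \<leftarrow> map_pmf (\<lambda>w. (front m w i j, ver w i (Suc j))) (weights A); return_pmf (st s y)}"
    by (simp add: bind_map_pmf)
  also have "\<dots> = do {y \<leftarrow> geo (a (Suc i) * b (Suc j)); x \<leftarrow> geo (a (Suc i)); r \<leftarrow> Pi_pmf R 0 (\<lambda>i. geo (a i));
      v \<leftarrow> geo (b (Suc j)); return_pmf (r(Suc i := y + (x - v)), y + (v - x))}"
    unfolding law R(1) using R(2,3)
    by (simp add: Pi_pmf_insert' pair_pmf_def bind_assoc_pmf bind_return_pmf st_def)
  \<comment> \<open>Independent draws commute; this brings the two increments at the corner and its weight together.\<close>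
  also have "\<dots> = do {r \<leftarrow> Pi_pmf R 0 (\<lambda>i. geo (a i)); x \<leftarrow> geo (a (Suc i));
      v \<leftarrow> geo (b (Suc j)); y \<leftarrow> geo (a (Suc i) * b (Suc j)); return_pmf (r(Suc i := y + (x - v)), y + (v - x))}"
    apply (subst bind_commute_pmf[of "geo (a (Suc i))" "Pi_pmf R 0 (\<lambda>i. geo (a i))"])
    apply (subst bind_commute_pmf[of "geo (a (Suc i) * b (Suc j))" "Pi_pmf R 0 (\<lambda>i. geo (a i))"])
    apply (subst bind_commute_pmf[of "geo (a (Suc i) * b (Suc j))" "geo (a (Suc i))"])
    apply (subst bind_commute_pmf[of "geo (a (Suc i) * b (Suc j))" "geo (b (Suc j))"])
    ..
  also have "\<dots> = do {r \<leftarrow> Pi_pmf R 0 (\<lambda>i. geo (a i)); x \<leftarrow> geo (a (Suc i));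
      v \<leftarrow> geo (b (Suc j)); return_pmf (r(Suc i := x), v)}"
    using a[of "Suc i"] b[of "Suc j"] by (subst corner_bind_geometric) auto
  also have "\<dots> = pair_pmf (row_law m) (geo (b (Suc j)))"
    unfolding R(1) using R(2,3)
    apply (simp add: Pi_pmf_insert' pair_pmf_def bind_assoc_pmf bind_return_pmf)
    apply (subst bind_commute_pmf[of "geo (a (Suc i))" "Pi_pmf R 0 (\<lambda>i. geo (a i))"])
    ..
  finally show ?thesis .
qed

text \<open>The Burke property: in every row the horizontal increments are independent and geometric with the
  same parameters as on the axis. A row is reached from the one below by starting with a fresh vertical boundary
  weight and flipping the corners from left to right; the last vertical increment is then dropped.\<close>

lemma row_law_hor:
  "map_pmf (\<lambda>w k. if k \<in> {1..m} then hor w k j else 0) (weights ({0..m} \<times> {0..j})) = row_law m"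
proof (induction j)
  case 0
  have "map_pmf (\<lambda>w k. if k \<in> {1..m} then w (k, 0) else 0) (weights ({0..m} \<times> {0})) = row_law m"
  proof -
    have "row_law m = map_pmf (\<lambda>w k. if k \<in> {1..m} then w k else 0) (Pi_pmf {0..m} 0 (\<lambda>i. geo (a i)))"
      by (rule Pi_pmf_subset) auto
    also have "Pi_pmf K 0 (\<lambda>i. geo (a i)) = map_pmf (\<lambda>w k. w (k, 0)) (weights (K \<times> {0}))" if "finite K" for K
      using that
    proof (induction K)
      case (insert x K)
      have "insert x K \<times> {0} = insert (x, 0) (K \<times> {0})" "(x, 0) \<notin> K \<times> {0}"
        "\<And>w y. (\<lambda>k. (w((x, 0) := y)) (k, 0)) = (\<lambda>k. w (k, 0))(x := y)"
        using insert by auto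
      with insert show ?case
        by (simp add: Pi_pmf_insert' map_bind_pmf b0 bind_map_pmf fun_upd_def)
    qed simp
    finally show ?thesis by (simp add: map_pmf_comp)
  qed
  moreover have "(if k \<in> {1..m} then hor w k 0 else 0) = (if k \<in> {1..m} then w (k, 0) else 0)" for w k
    by (cases k) auto
  ultimately show ?case by simp
next
  case (Suc j)
  have *: "map_pmf (\<lambda>w. (front m w i j, ver w i (Suc j))) (weights ({0..m} \<times> {0..j} \<union> {0..i} \<times> {Suc j}))
      = pair_pmf (row_law m) (geo (b (Suc j)))" if "i \<le> m" for i
    using that
  proof (induction i)
    case 0
    define A where "A = {0..m} \<times> {0..j}"
    have A: "{0..m} \<times> {0..j} \<union> {0..0} \<times> {Suc j} = insert (0, Suc j) A" "finite A" "(0, Suc j) \<notin> A"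
      by (auto simp: A_def)
    have f: "front m (w((0, Suc j) := y)) 0 j = (\<lambda>k. if k \<in> {1..m} then hor w k j else 0)" for w y
      unfolding front_def by (auto simp: fun_eq_iff intro!: hor_ver_cong)
    have "map_pmf (\<lambda>w. (front m w 0 j, ver w 0 (Suc j))) (weights (insert (0, Suc j) A))
       = do {y \<leftarrow> geo (b (Suc j)); h \<leftarrow> map_pmf (\<lambda>w k. if k \<in> {1..m} then hor w k j else 0) (weights A);
          return_pmf (h, y)}"
      using A(2,3) by (simp add: Pi_pmf_insert' map_bind_pmf f a0 bind_map_pmf)
    also have "\<dots> = pair_pmf (row_law m) (geo (b (Suc j)))"
      using Suc by (simp add: A_def pair_pmf_def bind_commute_pmf[of "geo (b (Suc j))"])
    finally show ?case by (simp only: A(1))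
  next
    case (Suc i)
    have "{0..m} \<times> {0..j} \<union> {0..Suc i} \<times> {Suc j}
      = insert (Suc i, Suc j) ({0..m} \<times> {0..j} \<union> {0..i} \<times> {Suc j})" by auto
    with corner_flip[OF _ Suc.prems _ refl] Suc show ?case by simp
  qed
  have D: "{0..m} \<times> {0..j} \<union> {0..m} \<times> {Suc j} = {0..m} \<times> {0..Suc j}" by auto
  have f: "front m w m j = (\<lambda>k. if k \<in> {1..m} then hor w k (Suc j) else 0)" for w
    by (auto simp: front_def fun_eq_iff)
  have "row_law m = map_pmf fst (map_pmf (\<lambda>w. (front m w m j, ver w m (Suc j)))
     (weights ({0..m} \<times> {0..j} \<union> {0..m} \<times> {Suc j})))"
    by (simp add: *[of m] map_fst_pair_pmf)
  then show ?case by (simp add: D map_pmf_comp f)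
qed

end

section \<open>The quenched mean of the last-passage time\<close>

lemma hor_ge: "w (Suc i, Suc j) \<le> hor w (Suc i) (Suc j)"
  and ver_ge: "w (Suc i, Suc j) \<le> ver w (Suc i) (Suc j)"
  by auto

text \<open>Both sides are \<open>H(i, j+1) - H(0, j)\<close>, computed along the two ways around the rectangle.\<close>

lemma sum_hor_Suc:
  "(\<Sum>k=1..i. hor w k (Suc j)) + w (0, Suc j) = (\<Sum>k=1..i. hor w k j) + ver w i (Suc j)"
  by (induction i) auto

text \<open>The right-hand side is the passage time \<open>H(m,n)\<close> with boundary weights, which dominates because the
  increments into a cell are at least its weight.\<close>

lemma last_passage_le_boundary:
  "last_passage (\<lambda>c. real (w c)) m n \<le> real ((\<Sum>k=1..m. hor w k n) + (\<Sum>l=1..n. w (0, l)))"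
proof (induction "\<lambda>c. real (w c)" m n rule: last_passage.induct)
  case (3 i j)
  define H where "H i j = (\<Sum>k=1..i. hor w k j) + (\<Sum>l=1..j. w (0, l))" for i j
  have "H i (Suc j) + w (Suc i, Suc j) \<le> H (Suc i) (Suc j)"
    using hor_ge[where w = w and i = i and j = j] by (simp add: H_def del: hor.simps)
  moreover have "H (Suc i) j + w (Suc i, Suc j) \<le> H (Suc i) (Suc j)"
    using sum_hor_Suc[where w = w and i = "Suc i" and j = j] ver_ge[where w = w and i = i and j = j] by (simp add: H_def del: hor.simps ver.simps)
  moreover have "last_passage (\<lambda>c. real (w c)) i (Suc j) \<le> H i (Suc j)"
    "last_passage (\<lambda>c. real (w c)) (Suc i) j \<le> H (Suc i) j"
    using 3 unfolding H_def by simp_all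
  ultimately have "last_passage (\<lambda>c. real (w c)) (Suc i) (Suc j) \<le> H (Suc i) (Suc j)"
    unfolding last_passage.simps by linarith
  then show ?case unfolding H_def .
qed (auto simp: sum_nonneg add_nonneg_nonneg)

lemma nn_integral_geo:
  assumes "0 < q" "q < 1"
  shows "(\<integral>\<^sup>+x. ennreal (real x) \<partial>geo q) = ennreal (q / (1 - q))"
    using expectation_geometric_pmf[of "1 - q"] integrable_real_geometric_pmf[of "1 - q"] assms
  by (subst nn_integral_eq_integral) auto

text \<open>On finitely many cells the real-valued product law is the image of an integer-valued product of
  probability mass functions. There the calculus of the probability monad is available.\<close>

lemma PiM_geometric_law_eq:
  assumes "finite J"
  shows "PiM J (\<lambda>x. geometric_law (q x))
    = distr (measure_pmf (Pi_pmf J 0 (\<lambda>x. geo (q x)))) (PiM J (\<lambda>x. geometric_law (q x))) (\<lambda>w. \<lambda>x\<in>J. real (w x))"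
    (is "_ = ?D")
proof -
  interpret product_prob_space "\<lambda>x. geometric_law (q x)"
    by (simp add: product_prob_space_def product_prob_space_axioms_def product_sigma_finite_def
        prob_space_geometric_law prob_space_imp_sigma_finite)
  have sp: "space (geometric_law r) = {0..}" for r by (simp add: geometric_law_def space_restrict_space)
  have f: "(\<lambda>w. \<lambda>x\<in>J. real (w x)) \<in> measure_pmf p \<rightarrow>\<^sub>M PiM J (\<lambda>x. geometric_law (q x))" for p
    by (auto simp: space_PiM sp)
  have g: "real \<in> measure_pmf p \<rightarrow>\<^sub>M restrict_space borel {0..}" for p
    by (auto simp: measurable_restrict_space2_iff)
  have "?D = PiM J (\<lambda>x. geometric_law (q x))"
  proof (rule PiM_eqI[OF assms])
    fix A assume A: "\<And>i. i \<in> J \<Longrightarrow> A i \<in> sets (geometric_law (q i))"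
    have "emeasure ?D (Pi\<^sub>E J A) = emeasure (Pi_pmf J 0 (\<lambda>x. geo (q x))) (Pi J (\<lambda>x. real -` A x))"
      using A assms by (subst emeasure_distr[OF f]) (auto intro!: sets_PiM_I_finite arg_cong[where f = "emeasure _"] simp: Pi_iff split: if_splits)
    also have "\<dots> = (\<Prod>x\<in>J. emeasure (geo (q x)) (real -` A x))"
      using assms by (simp add: measure_pmf.emeasure_eq_measure measure_Pi_pmf_Pi prod_ennreal)
    also have "\<dots> = (\<Prod>x\<in>J. emeasure (geometric_law (q x)) (A x))"
      using A unfolding geometric_law_def by (intro prod.cong refl) (subst emeasure_distr[OF g], auto)
    finally show "emeasure ?D (Pi\<^sub>E J A) = (\<Prod>x\<in>J. emeasure (geometric_law (q x)) (A x))" .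
  qed simp
  then show ?thesis ..
qed

text \<open>Only the rectangle of the cells up to \<open>(m, n)\<close> matters. The weights on it extend to weights
  on the rectangle with boundary, where the increments have known means.\<close>

lemma (in boundary_params) nn_integral_last_passage_le:
  "(\<integral>\<^sup>+w. ennreal (last_passage w m n) \<partial>quenched_law a b)
     \<le> (\<Sum>i=1..m. ennreal (a i / (1 - a i))) + (\<Sum>j=1..n. ennreal (b j / (1 - b j)))"
proof -
  define J where "J = {1..m} \<times> {1..n}"
  define D where "D = {0..m} \<times> {0..n}"
  define q where "q = (\<lambda>(i, j). a i * b j)"
  have "finite J" "finite D" "J \<subseteq> D" by (auto simp: J_def D_def)
  have Q: "quenched_law a b = PiM ({1..} \<times> {1..}) (\<lambda>x. geometric_law (q x))"
    unfolding quenched_law_def q_def by (simp add: case_prod_unfold)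
  have setsJ: "sets (PiM J (\<lambda>x. geometric_law (q x))) = sets (PiM J (\<lambda>_. restrict_space borel {0..}))"
    by (rule sets_PiM_cong) auto
  have lpJ: "last_passage w m n = last_passage (restrict w J) m n" for w
    by (rule last_passage_cong) (auto simp: J_def)
  \<comment> \<open>Measurability on the finite rectangle is inherited from the infinite quadrant by padding with zeros.\<close>
  have pad: "(\<lambda>w. \<lambda>x\<in>{1..} \<times> {1..}. if x \<in> J then w x else 0) \<in> PiM J (\<lambda>x. geometric_law (q x)) \<rightarrow>\<^sub>M weight_space"
  proof (rule measurable_restrict)
    fix x :: "nat \<times> nat"
    show "(\<lambda>w. if x \<in> J then w x else 0) \<in> PiM J (\<lambda>x. geometric_law (q x)) \<rightarrow>\<^sub>M restrict_space borel {0..}"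
      unfolding measurable_cong_sets[OF setsJ refl]
      by (cases "x \<in> J") (auto simp: space_restrict_space)
  qed
  have "(\<lambda>w. last_passage (\<lambda>x\<in>{1..} \<times> {1..}. if x \<in> J then w x else 0) m n)
      \<in> borel_measurable (PiM J (\<lambda>x. geometric_law (q x)))"
    using measurable_compose[OF pad measurable_last_passage[of m n]] by (simp add: comp_def)
  also have "(\<lambda>w. last_passage (\<lambda>x\<in>{1..} \<times> {1..}. if x \<in> J then w x else 0) m n) = (\<lambda>w. last_passage w m n)"
    by (intro ext last_passage_cong) (auto simp: J_def)
  finally have mJ [measurable]: "(\<lambda>w. last_passage w m n) \<in> borel_measurable (PiM J (\<lambda>x. geometric_law (q x)))" .
  have res: "(\<lambda>w. restrict w J) \<in> PiM ({1..} \<times> {1..}) (\<lambda>x. geometric_law (q x)) \<rightarrow>\<^sub>M PiM J (\<lambda>x. geometric_law (q x))"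
    by (rule measurable_restrict_subset) (auto simp: J_def)
  have sp: "space (geometric_law r) = {0..}" for r by (simp add: geometric_law_def space_restrict_space)
  have f: "(\<lambda>w. \<lambda>x\<in>J. real (w x)) \<in> measure_pmf p \<rightarrow>\<^sub>M PiM J (\<lambda>x. geometric_law (q x))" for p
    by (auto simp: space_PiM sp)

  have "(\<integral>\<^sup>+w. ennreal (last_passage w m n) \<partial>quenched_law a b)
    = (\<integral>\<^sup>+w. ennreal (last_passage (restrict w J) m n) \<partial>PiM ({1..} \<times> {1..}) (\<lambda>x. geometric_law (q x)))"
    unfolding Q by (rule nn_integral_cong, subst lpJ, rule refl)
  also have "\<dots> = (\<integral>\<^sup>+w. ennreal (last_passage w m n) \<partial>distr (PiM ({1..} \<times> {1..}) (\<lambda>x. geometric_law (q x)))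
      (PiM J (\<lambda>x. geometric_law (q x))) (\<lambda>w. restrict w J))"
    by (rule nn_integral_distr[OF res, symmetric]) simp
  also have "distr (PiM ({1..} \<times> {1..}) (\<lambda>x. geometric_law (q x)))
      (PiM J (\<lambda>x. geometric_law (q x))) (\<lambda>w. restrict w J) = PiM J (\<lambda>x. geometric_law (q x))"
    using distr_PiM_reindex[of "{1..} \<times> {1..}" "\<lambda>x. geometric_law (q x)" "\<lambda>x. x" J]
    by (simp add: J_def prob_space_geometric_law Pi_iff subset_eq restrict_def[abs_def])
  also have "(\<integral>\<^sup>+w. ennreal (last_passage w m n) \<partial>PiM J (\<lambda>x. geometric_law (q x)))
    = (\<integral>\<^sup>+w. ennreal (last_passage (\<lambda>x\<in>J. real (w x)) m n) \<partial>Pi_pmf J 0 (\<lambda>x. geo (q x)))"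
    by (subst PiM_geometric_law_eq[OF \<open>finite J\<close>], subst nn_integral_distr[OF f]) auto
  also have "\<dots> = (\<integral>\<^sup>+w. ennreal (last_passage (\<lambda>x. real (w x)) m n) \<partial>weights D)"
  proof -
    have "Pi_pmf J 0 (\<lambda>x. geo (q x)) = map_pmf (\<lambda>f x. if x \<in> J then f x else 0) (weights D)"
      unfolding q_def case_prod_unfold by (rule Pi_pmf_subset) fact+
    then show ?thesis by (auto intro!: nn_integral_cong arg_cong[where f = ennreal] last_passage_cong simp: J_def)
  qed
  also have "\<dots> \<le> (\<integral>\<^sup>+w. (\<Sum>k=1..m. ennreal (hor w k n)) + (\<Sum>l=1..n. ennreal (w (0, l))) \<partial>weights D)"
    by (intro nn_integral_mono)
       (use last_passage_le_boundary in \<open>auto simp: sum_nonneg simp flip: ennreal_plus intro!: ennreal_leI\<close>)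
  also have "\<dots> = (\<Sum>k=1..m. \<integral>\<^sup>+w. ennreal (hor w k n) \<partial>weights D) + (\<Sum>l=1..n. \<integral>\<^sup>+w. ennreal (w (0, l)) \<partial>weights D)"
    by (simp add: nn_integral_add nn_integral_sum del: sum_ennreal)
  also have "(\<Sum>k=1..m. \<integral>\<^sup>+w. ennreal (hor w k n) \<partial>weights D) = (\<Sum>k=1..m. ennreal (a k / (1 - a k)))"
  proof (intro sum.cong refl)
    fix k assume k: "k \<in> {1..m}"
    have "geo (a k) = map_pmf (\<lambda>f. f k) (row_law m)"
      using k by (subst Pi_pmf_component) auto
    also have "\<dots> = map_pmf (\<lambda>w. hor w k n) (weights D)"
      using k by (subst row_law_hor[of m n, symmetric]) (simp add: map_pmf_comp D_def)
    finally have "(\<integral>\<^sup>+w. ennreal (hor w k n) \<partial>weights D) = (\<integral>\<^sup>+x. ennreal (real x) \<partial>geo (a k))"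
      by simp
    then show "(\<integral>\<^sup>+w. ennreal (hor w k n) \<partial>weights D) = ennreal (a k / (1 - a k))"
      using nn_integral_geo[of "a k"] a[of k] k by simp
  qed
  also have "(\<Sum>l=1..n. \<integral>\<^sup>+w. ennreal (w (0, l)) \<partial>weights D) = (\<Sum>l=1..n. ennreal (b l / (1 - b l)))"
  proof (intro sum.cong refl)
    fix l assume l: "l \<in> {1..n}"
    have "geo (b l) = map_pmf (\<lambda>w. w (0, l)) (weights D)"
      using l by (subst Pi_pmf_component) (auto simp: D_def a0)
    then have "(\<integral>\<^sup>+w. ennreal (w (0, l)) \<partial>weights D) = (\<integral>\<^sup>+x. ennreal (real x) \<partial>geo (b l))"
      by simp
    then show "(\<integral>\<^sup>+w. ennreal (w (0, l)) \<partial>weights D) = ennreal (b l / (1 - b l))"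
      using nn_integral_geo[of "b l"] b[of l] l by simp
  qed
  finally show ?thesis .
qed

section \<open>The environment and the annealed law\<close>

lemma unit_seqs_bounds: "a \<in> space unit_seqs \<Longrightarrow> 1 \<le> i \<Longrightarrow> 0 < a i \<and> a i < 1"
  by (auto simp: space_PiM space_restrict_space PiE_iff)

lemma boundary_params_unit_seqs:
  assumes "a \<in> space unit_seqs" "b \<in> space unit_seqs"
  shows "boundary_params (a(0 := 1)) (b(0 := 1))"
  using unit_seqs_bounds[OF assms(1)] unit_seqs_bounds[OF assms(2)] unfolding boundary_params_def by simp

lemma quenched_law_upd_0: "quenched_law (a(0 := x)) (b(0 := y)) = quenched_law a b"
proof -
  have "(case p of (i, j) \<Rightarrow> geometric_law ((a(0 := x)) i * (b(0 := y)) j))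
     = (case p of (i, j) \<Rightarrow> geometric_law (a i * b j))" if "p \<in> {1..} \<times> {1..}" for p
    using that by (cases p) simp
  then show ?thesis
    unfolding quenched_law_def by (intro PiM_cong refl)
qed

lemma shift_apply: "1 \<le> i \<Longrightarrow> shift k c i = c (i + k)"
  by (simp add: shift_def)

locale random_environment =
  fixes \<mu> :: "((nat \<Rightarrow> real) \<times> (nat \<Rightarrow> real)) measure"
  assumes env: "environment \<mu>"
begin

sublocale prob_space \<mu> using env by (simp add: environment_def)

lemma sets_env [measurable_cong]: "sets \<mu> = sets (unit_seqs \<Otimes>\<^sub>M unit_seqs)"
  using env by (simp add: environment_def)

lemma space_env: "\<omega> \<in> space \<mu> \<longleftrightarrow> fst \<omega> \<in> space unit_seqs \<and> snd \<omega> \<in> space unit_seqs"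
  by (simp add: sets_eq_imp_space_eq[OF sets_env] space_pair_measure mem_Times_iff)

lemma env_bounds:
  assumes "\<omega> \<in> space \<mu>" "1 \<le> i"
  shows "0 < fst \<omega> i" "fst \<omega> i < 1" "0 < snd \<omega> i" "snd \<omega> i < 1"
  using unit_seqs_bounds[of "fst \<omega>" i] unit_seqs_bounds[of "snd \<omega>" i] assms unfolding space_env by blast+

lemma measurable_coordinate:
  assumes "1 \<le> i"
  shows "(\<lambda>c. c i) \<in> unit_seqs \<rightarrow>\<^sub>M borel"
proof -
  have "i \<in> {1..}" using assms by simp
  from measurable_component_singleton[OF this, of "\<lambda>_. restrict_space borel {0<..<1::real}"]
  show ?thesis by (simp add: measurable_restrict_space2_iff)
qed

lemma measurable_env:
  assumes "1 \<le> i"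
  shows "(\<lambda>\<omega>. fst \<omega> i) \<in> borel_measurable \<mu>" "(\<lambda>\<omega>. snd \<omega> i) \<in> borel_measurable \<mu>"
  unfolding measurable_cong_sets[OF sets_env refl]
  using measurable_compose[OF measurable_fst measurable_coordinate[OF assms]]
    measurable_compose[OF measurable_snd measurable_coordinate[OF assms]] by auto

lemma measurable_quenched:
  "(\<lambda>(a, b). quenched_law a b) \<in> \<mu> \<rightarrow>\<^sub>M subprob_algebra weight_space"
  unfolding measurable_cong_sets[OF sets_env refl]
  by (rule measurable_prob_algebraD[OF measurable_quenched_law])

lemma sets_annealed [measurable_cong]: "sets (annealed_law \<mu>) = sets weight_space"
  unfolding annealed_law_def
  by (rule sets_bind) (auto simp: sets_quenched_law not_empty)

lemma prob_space_annealed: "prob_space (annealed_law \<mu>)"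
  unfolding annealed_law_def
  by (rule prob_space_bind[OF _ measurable_quenched]) (auto simp: prob_space_quenched_law)

lemma nn_integral_annealed:
  assumes "f \<in> borel_measurable weight_space"
  shows "(\<integral>\<^sup>+w. f w \<partial>annealed_law \<mu>) = (\<integral>\<^sup>+\<omega>. (\<integral>\<^sup>+w. f w \<partial>quenched_law (fst \<omega>) (snd \<omega>)) \<partial>\<mu>)"
  unfolding annealed_law_def nn_integral_bind[OF assms measurable_quenched] by (simp add: case_prod_unfold)

lemma shift_invariant:
  assumes "1 \<le> k" "1 \<le> l"
  shows "map_prod (shift k) (shift l) \<in> \<mu> \<rightarrow>\<^sub>M \<mu>" "distr \<mu> \<mu> (map_prod (shift k) (shift l)) = \<mu>"
  using env assms by (auto simp: environment_def ergodic_def measure_preserving_def)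

text \<open>Shifting both sequences by \<open>i - 1\<close> moves coordinate \<open>i\<close> to coordinate \<open>1\<close> and preserves \<open>\<mu>\<close>.\<close>

lemma nn_integral_coordinate:
  assumes [measurable]: "f \<in> borel_measurable borel" and i: "1 \<le> i"
  shows "(\<integral>\<^sup>+\<omega>. f (fst \<omega> i) \<partial>\<mu>) = (\<integral>\<^sup>+\<omega>. f (fst \<omega> 1) \<partial>\<mu>)" (is ?A)
    and "(\<integral>\<^sup>+\<omega>. f (snd \<omega> i) \<partial>\<mu>) = (\<integral>\<^sup>+\<omega>. f (snd \<omega> 1) \<partial>\<mu>)" (is ?B)
proof -
  have "?A \<and> ?B"
  proof (cases "i = 1")
    case False
    define T where "T = map_prod (shift (i - 1)) (shift (i - 1))"
    have T: "T \<in> \<mu> \<rightarrow>\<^sub>M \<mu>" "distr \<mu> \<mu> T = \<mu>"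
      using shift_invariant[of "i - 1" "i - 1"] False i by (auto simp: T_def)
    have c: "fst (T \<omega>) 1 = fst \<omega> i" "snd (T \<omega>) 1 = snd \<omega> i" for \<omega>
      using i by (cases \<omega>; simp add: T_def shift_apply)+
    have "(\<integral>\<^sup>+\<omega>. h (h' \<omega>) \<partial>distr \<mu> \<mu> T) = (\<integral>\<^sup>+\<omega>. h (h' (T \<omega>)) \<partial>\<mu>)"
      if "h' \<in> borel_measurable \<mu>" "h \<in> borel_measurable borel" for h :: "real \<Rightarrow> ennreal" and h'
      by (rule nn_integral_distr[OF T(1)]) (use measurable_compose[OF that] in simp)
    from this[OF measurable_env(1)[OF le_refl] assms(1)] this[OF measurable_env(2)[OF le_refl] assms(1)]
    have "(\<integral>\<^sup>+\<omega>. f (fst \<omega> 1) \<partial>distr \<mu> \<mu> T) = (\<integral>\<^sup>+\<omega>. f (fst \<omega> i) \<partial>\<mu>)"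
      "(\<integral>\<^sup>+\<omega>. f (snd \<omega> 1) \<partial>distr \<mu> \<mu> T) = (\<integral>\<^sup>+\<omega>. f (snd \<omega> i) \<partial>\<mu>)"
      by (simp_all only: c)
    then show ?thesis unfolding T(2) by simp
  qed simp
  then show ?A ?B by auto
qed

end

section \<open>Upper bound for the shape function\<close>

context random_environment
begin

definition mean_a :: ennreal where "mean_a = (\<integral>\<^sup>+\<omega>. ennreal (fst \<omega> 1 / (1 - fst \<omega> 1)) \<partial>\<mu>)"
definition mean_b :: ennreal where "mean_b = (\<integral>\<^sup>+\<omega>. ennreal (snd \<omega> 1 / (1 - snd \<omega> 1)) \<partial>\<mu>)"

lemma nn_integral_last_passage_annealed_le:
  "(\<integral>\<^sup>+w. ennreal (last_passage w m n) \<partial>annealed_law \<mu>) \<le> of_nat m * mean_a + of_nat n * mean_b"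
proof -
  have "(\<integral>\<^sup>+w. ennreal (last_passage w m n) \<partial>annealed_law \<mu>)
    = (\<integral>\<^sup>+\<omega>. (\<integral>\<^sup>+w. ennreal (last_passage w m n) \<partial>quenched_law (fst \<omega>) (snd \<omega>)) \<partial>\<mu>)"
    by (rule nn_integral_annealed) measurable
  also have "\<dots> \<le> (\<integral>\<^sup>+\<omega>. (\<Sum>i=1..m. ennreal (fst \<omega> i / (1 - fst \<omega> i))) + (\<Sum>j=1..n. ennreal (snd \<omega> j / (1 - snd \<omega> j))) \<partial>\<mu>)"
  proof (rule nn_integral_mono)
    fix \<omega> assume "\<omega> \<in> space \<mu>"
    then interpret boundary_params "(fst \<omega>)(0 := 1)" "(snd \<omega>)(0 := 1)"
      by (intro boundary_params_unit_seqs) (auto simp: space_env)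
    show "(\<integral>\<^sup>+w. ennreal (last_passage w m n) \<partial>quenched_law (fst \<omega>) (snd \<omega>))
      \<le> (\<Sum>i=1..m. ennreal (fst \<omega> i / (1 - fst \<omega> i))) + (\<Sum>j=1..n. ennreal (snd \<omega> j / (1 - snd \<omega> j)))"
      using nn_integral_last_passage_le[of m n] by (simp add: quenched_law_upd_0)
  qed
  also have "\<dots> = (\<Sum>i=1..m. \<integral>\<^sup>+\<omega>. ennreal (fst \<omega> i / (1 - fst \<omega> i)) \<partial>\<mu>) + (\<Sum>j=1..n. \<integral>\<^sup>+\<omega>. ennreal (snd \<omega> j / (1 - snd \<omega> j)) \<partial>\<mu>)"
  proof -
    have m: "(\<lambda>\<omega>. ennreal (fst \<omega> i / (1 - fst \<omega> i))) \<in> borel_measurable \<mu>"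
      "(\<lambda>\<omega>. ennreal (snd \<omega> i / (1 - snd \<omega> i))) \<in> borel_measurable \<mu>" if "1 \<le> i" for i
      using measurable_env[OF that] by auto
    show ?thesis
      by (subst nn_integral_add; (intro borel_measurable_sum m)?)
         (auto intro!: arg_cong2[where f = "(+)"] nn_integral_sum m simp del: sum_ennreal)
  qed
  also have "\<dots> = (\<Sum>i=1..m. mean_a) + (\<Sum>j=1..n. mean_b)"
  proof -
    note * = nn_integral_coordinate[where f = "\<lambda>x. ennreal (x / (1 - x))", folded mean_a_def mean_b_def]
    have "(\<integral>\<^sup>+\<omega>. ennreal (fst \<omega> i / (1 - fst \<omega> i)) \<partial>\<mu>) = mean_a"
      "(\<integral>\<^sup>+\<omega>. ennreal (snd \<omega> i / (1 - snd \<omega> i)) \<partial>\<mu>) = mean_b" if "1 \<le> i" for i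
      by (rule *[OF _ that], measurable)+
    then show ?thesis by simp
  qed
  finally show ?thesis by simp
qed

text \<open>The shape is a deterministic limit, so it equals its own mean, and Fatou's lemma reduces the bound
  to the means of the passage times.\<close>

lemma shape_le:
  assumes g: "shape_function \<mu> g" and "0 < s" "0 < t"
  shows "g s t \<le> ennreal s * mean_a + ennreal t * mean_b"
proof -
  interpret P: prob_space "annealed_law \<mu>" by (rule prob_space_annealed)
  define X where "X n w = ennreal (last_passage w (nat \<lfloor>real n * s\<rfloor>) (nat \<lfloor>real n * t\<rfloor>) / real n)" for n w
  have "AE w in annealed_law \<mu>. liminf (\<lambda>n. X n w) = g s t"
    using g unfolding shape_function_def
    by eventually_elim (use assms(2,3) in \<open>auto intro!: lim_imp_Liminf simp: X_def\<close>)
  then have "g s t = (\<integral>\<^sup>+w. liminf (\<lambda>n. X n w) \<partial>annealed_law \<mu>)"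
    using P.emeasure_space_1 by (subst nn_integral_cong_AE[where v = "\<lambda>_. g s t"]) auto
  also have "\<dots> \<le> liminf (\<lambda>n. \<integral>\<^sup>+w. X n w \<partial>annealed_law \<mu>)"
    by (rule nn_integral_liminf) (unfold X_def, measurable)
  also have "\<dots> \<le> liminf (\<lambda>n. ennreal s * mean_a + ennreal t * mean_b)"
  proof (intro Liminf_mono eventually_sequentiallyI[of 1])
    fix n :: nat assume n: "1 \<le> n"
    have fl: "of_nat (nat \<lfloor>real n * r\<rfloor>) / ennreal (real n) \<le> ennreal r" if "0 < r" for r
    proof -
      have "real (nat \<lfloor>real n * r\<rfloor>) / real n \<le> r"
        using n that by (simp add: field_simps)
      then show ?thesis using n
        by (simp add: ennreal_of_nat_eq_real_of_nat divide_ennreal ennreal_leI)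
    qed
    have "(\<integral>\<^sup>+w. X n w \<partial>annealed_law \<mu>)
      = (\<integral>\<^sup>+w. ennreal (last_passage w (nat \<lfloor>real n * s\<rfloor>) (nat \<lfloor>real n * t\<rfloor>)) / ennreal (real n) \<partial>annealed_law \<mu>)"
      using n by (auto simp: X_def divide_ennreal_def divide_inverse ennreal_mult'' inverse_ennreal intro!: nn_integral_cong)
    also have "\<dots> = (\<integral>\<^sup>+w. ennreal (last_passage w (nat \<lfloor>real n * s\<rfloor>) (nat \<lfloor>real n * t\<rfloor>)) \<partial>annealed_law \<mu>) / ennreal (real n)"
      by (rule nn_integral_divide) measurable
    also have "\<dots> \<le> (of_nat (nat \<lfloor>real n * s\<rfloor>) * mean_a + of_nat (nat \<lfloor>real n * t\<rfloor>) * mean_b) / ennreal (real n)"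
      by (intro divide_right_mono_ennreal nn_integral_last_passage_annealed_le)
    also have "\<dots> = (of_nat (nat \<lfloor>real n * s\<rfloor>) / ennreal (real n)) * mean_a + (of_nat (nat \<lfloor>real n * t\<rfloor>) / ennreal (real n)) * mean_b"
      by (simp add: divide_ennreal_def distrib_left distrib_right mult_ac)
    also have "\<dots> \<le> ennreal s * mean_a + ennreal t * mean_b"
      by (intro add_mono mult_right_mono fl assms) auto
    finally show "(\<integral>\<^sup>+w. X n w \<partial>annealed_law \<mu>) \<le> ennreal s * mean_a + ennreal t * mean_b" .
  qed
  also have "\<dots> = ennreal s * mean_a + ennreal t * mean_b"
    by (simp add: Liminf_const)
  finally show ?thesis .
qed

end

section \<open>Ergodic averages of the environment\<close>

lemma floor_average_tendsto:
  assumes "0 < r"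
  shows "(\<lambda>n. real (nat \<lfloor>real n * r\<rfloor>) / real n) \<longlonglongrightarrow> r"
proof (rule tendsto_sandwich)
  have "(\<lambda>n. r - 1 / real n) \<longlonglongrightarrow> r - 0"
    by (intro tendsto_diff tendsto_const lim_1_over_n)
  then show "(\<lambda>n. r - 1 / real n) \<longlonglongrightarrow> r" by simp
  show "\<forall>\<^sub>F n in sequentially. r - 1 / real n \<le> real (nat \<lfloor>real n * r\<rfloor>) / real n"
  proof (rule eventually_sequentiallyI[of 1])
    fix n :: nat assume n: "1 \<le> n"
    have "real n * r - 1 \<le> real (nat \<lfloor>real n * r\<rfloor>)" using assms by linarith
    then have "(real n * r - 1) / real n \<le> real (nat \<lfloor>real n * r\<rfloor>) / real n"
      by (rule divide_right_mono) simp
    then show "r - 1 / real n \<le> real (nat \<lfloor>real n * r\<rfloor>) / real n"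
      using n by (simp add: diff_divide_distrib)
  qed
  show "\<forall>\<^sub>F n in sequentially. real (nat \<lfloor>real n * r\<rfloor>) / real n \<le> r"
  proof (rule eventually_sequentiallyI[of 1])
    fix n :: nat assume n: "1 \<le> n"
    have "real (nat \<lfloor>real n * r\<rfloor>) \<le> r * real n" using assms by (simp add: mult.commute)
    then show "real (nat \<lfloor>real n * r\<rfloor>) / real n \<le> r" using n by (simp add: pos_divide_le_eq)
  qed
qed simp

text \<open>Two averages that differ by one bounded summand differ by at most \<open>C / n\<close>, which the upper limit ignores.\<close>

lemma limsup_ennreal_mono_vanishing:
  fixes x y :: "nat \<Rightarrow> real"
  assumes "\<And>n. 0 \<le> y n" "0 \<le> C" and le: "\<And>n. x n \<le> y n + C / real n"
  shows "limsup (\<lambda>n. ennreal (x n)) \<le> limsup (\<lambda>n. ennreal (y n))"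
proof (rule ennreal_le_epsilon)
  fix e :: real assume "0 < e"
  have "(\<lambda>n. C * (1 / real n)) \<longlonglongrightarrow> C * 0" by (intro tendsto_mult tendsto_const lim_1_over_n)
  then have ev: "eventually (\<lambda>n. C / real n < e) sequentially"
    using \<open>0 < e\<close> by (auto dest!: order_tendstoD(2))
  have "limsup (\<lambda>n. ennreal (x n)) \<le> limsup (\<lambda>n. ennreal (y n) + ennreal e)"
  proof (rule Limsup_mono)
    show "\<forall>\<^sub>F n in sequentially. ennreal (x n) \<le> ennreal (y n) + ennreal e"
      using ev
    proof eventually_elim
      case (elim n)
      then have "x n \<le> y n + e" using le[of n] by linarith
      then show ?case using assms(1)[of n] \<open>0 < e\<close> by (simp add: ennreal_leI flip: ennreal_plus)
    qed
  qed
  also have "\<dots> = limsup (\<lambda>n. ennreal (y n)) + ennreal e"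
    by (rule Limsup_compose_continuous_mono) (auto intro!: continuous_on_add_ennreal continuous_on_id continuous_on_const monoI add_right_mono)
  finally show "limsup (\<lambda>n. ennreal (x n)) \<le> limsup (\<lambda>n. ennreal (y n)) + ennreal e" .
qed

context random_environment
begin

text \<open>The upper limit \<open>Z\<close> of the averages has mean at least \<open>r E[u\<^sub>1]\<close> by the reversed Fatou inequality for bounded
  functions. It is shift invariant, so the event \<open>Z \<le> d\<close> has probability \<open>0\<close> or \<open>1\<close>, and probability
  \<open>1\<close> would make the mean of \<open>Z\<close> at most \<open>d\<close>.\<close>

lemma limsup_average_ge:
  fixes u :: "nat \<Rightarrow> (nat \<Rightarrow> real) \<times> (nat \<Rightarrow> real) \<Rightarrow> real"
  assumes u [measurable]: "\<And>i. u (Suc i) \<in> borel_measurable \<mu>"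
    and stat: "\<And>i \<omega>. \<omega> \<in> space \<mu> \<Longrightarrow> u (Suc i) (map_prod (shift 1) (shift 1) \<omega>) = u (Suc (Suc i)) \<omega>"
    and bd: "\<And>i \<omega>. \<omega> \<in> space \<mu> \<Longrightarrow> 0 \<le> u (Suc i) \<omega> \<and> u (Suc i) \<omega> \<le> C"
    and r: "0 < r" and d: "d < ennreal r * (\<integral>\<^sup>+\<omega>. ennreal (u 1 \<omega>) \<partial>\<mu>)"
  shows "AE \<omega> in \<mu>. d < limsup (\<lambda>n. ennreal ((\<Sum>i<nat \<lfloor>real n * r\<rfloor>. u (Suc i) \<omega>) / real n))"
proof -
  define T :: "(nat \<Rightarrow> real) \<times> (nat \<Rightarrow> real) \<Rightarrow> (nat \<Rightarrow> real) \<times> (nat \<Rightarrow> real)"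
    where "T = map_prod (shift 1) (shift 1)"
  have T: "T \<in> \<mu> \<rightarrow>\<^sub>M \<mu>" "distr \<mu> \<mu> T = \<mu>" using shift_invariant[of 1 1] by (auto simp: T_def)
  have stat': "u (Suc i) (T \<omega>) = u (Suc (Suc i)) \<omega>" if "\<omega> \<in> space \<mu>" for i \<omega>
    using stat[OF that] by (simp only: T_def)
  obtain \<omega>0 where \<omega>0: "\<omega>0 \<in> space \<mu>" using not_empty by blast
  have C: "0 \<le> C" using bd[OF \<omega>0, of 0] by linarith
  define f where "f n = nat \<lfloor>real n * r\<rfloor>" for n
  define S where "S n \<omega> = (\<Sum>i<f n. u (Suc i) \<omega>) / real n" for n \<omega>
  define Z where "Z \<omega> = limsup (\<lambda>n. ennreal (S n \<omega>))" for \<omega>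
  define c where "c = ennreal r * (\<integral>\<^sup>+\<omega>. ennreal (u 1 \<omega>) \<partial>\<mu>)"
  have [measurable]: "S n \<in> borel_measurable \<mu>" for n unfolding S_def by measurable
  have [measurable]: "Z \<in> borel_measurable \<mu>" unfolding Z_def by measurable
  have S0: "0 \<le> S n \<omega>" if "\<omega> \<in> space \<mu>" for n \<omega>
    unfolding S_def using bd[OF that] by (intro divide_nonneg_nonneg sum_nonneg) auto
  have fr: "real (f n) / real n \<le> r" for n
    using r by (cases "n = 0") (auto simp: f_def field_simps)

  have mean: "c \<le> (\<integral>\<^sup>+\<omega>. Z \<omega> \<partial>\<mu>)"
  proof -
    have Eu: "(\<integral>\<^sup>+\<omega>. ennreal (u (Suc i) \<omega>) \<partial>\<mu>) = (\<integral>\<^sup>+\<omega>. ennreal (u 1 \<omega>) \<partial>\<mu>)" for i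
    proof (induction i)
      case (Suc i)
      have "(\<integral>\<^sup>+\<omega>. ennreal (u (Suc (Suc i)) \<omega>) \<partial>\<mu>) = (\<integral>\<^sup>+\<omega>. ennreal (u (Suc i) (T \<omega>)) \<partial>\<mu>)"
        by (intro nn_integral_cong) (simp add: stat')
      also have "\<dots> = (\<integral>\<^sup>+\<omega>. ennreal (u (Suc i) \<omega>) \<partial>distr \<mu> \<mu> T)"
        by (rule nn_integral_distr[OF T(1), symmetric]) simp
      finally show ?case unfolding T(2) using Suc by simp
    qed simp
    have "(\<integral>\<^sup>+\<omega>. ennreal (S n \<omega>) \<partial>\<mu>) = ennreal (real (f n) / real n) * (\<integral>\<^sup>+\<omega>. ennreal (u 1 \<omega>) \<partial>\<mu>)" for n
    proof -
      have "(\<integral>\<^sup>+\<omega>. ennreal (S n \<omega>) \<partial>\<mu>) = (\<integral>\<^sup>+\<omega>. ennreal (1 / real n) * (\<Sum>i<f n. ennreal (u (Suc i) \<omega>)) \<partial>\<mu>)"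
      proof (rule nn_integral_cong)
        fix \<omega> assume "\<omega> \<in> space \<mu>"
        then show "ennreal (S n \<omega>) = ennreal (1 / real n) * (\<Sum>i<f n. ennreal (u (Suc i) \<omega>))"
          using bd by (simp add: S_def sum_nonneg flip: ennreal_mult)
      qed
      also have "\<dots> = ennreal (1 / real n) * (\<Sum>i<f n. \<integral>\<^sup>+\<omega>. ennreal (u (Suc i) \<omega>) \<partial>\<mu>)"
        by (simp add: nn_integral_cmult nn_integral_sum del: sum_ennreal)
      also have "\<dots> = ennreal (real (f n) / real n) * (\<integral>\<^sup>+\<omega>. ennreal (u 1 \<omega>) \<partial>\<mu>)"
        unfolding Eu by (simp add: ennreal_of_nat_eq_real_of_nat mult.assoc[symmetric] flip: ennreal_mult)
      finally show ?thesis .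
    qed
    moreover have "(\<lambda>n. ennreal (real (f n) / real n) * (\<integral>\<^sup>+\<omega>. ennreal (u 1 \<omega>) \<partial>\<mu>)) \<longlonglongrightarrow> c"
      unfolding c_def f_def using floor_average_tendsto[OF r] r
      by (intro tendsto_mult_ennreal tendsto_ennrealI tendsto_const) auto
    ultimately have "c = limsup (\<lambda>n. \<integral>\<^sup>+\<omega>. ennreal (S n \<omega>) \<partial>\<mu>)"
      by (simp add: lim_imp_Limsup)
    also have "\<dots> \<le> (\<integral>\<^sup>+\<omega>. Z \<omega> \<partial>\<mu>)"
      unfolding Z_def
    proof (rule nn_integral_limsup)
      fix n
      show "AE \<omega> in \<mu>. ennreal (S n \<omega>) \<le> ennreal (r * C)"
      proof (rule AE_I2)
        fix \<omega> assume \<omega>: "\<omega> \<in> space \<mu>"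
        have "(\<Sum>i<f n. u (Suc i) \<omega>) \<le> real (f n) * C"
          using bd[OF \<omega>] sum_bounded_above[of "{..<f n}" "\<lambda>i. u (Suc i) \<omega>" C] by simp
        then have "S n \<omega> \<le> real (f n) / real n * C"
          unfolding S_def by (simp add: divide_right_mono)
        also have "\<dots> \<le> r * C" by (intro mult_right_mono fr C)
        finally show "ennreal (S n \<omega>) \<le> ennreal (r * C)" by (rule ennreal_leI)
      qed
    qed (auto simp: emeasure_space_1)
    finally show ?thesis .
  qed

  have inv: "Z (T \<omega>) = Z \<omega>" if \<omega>: "\<omega> \<in> space \<mu>" for \<omega>
  proof -
    have T\<omega>: "T \<omega> \<in> space \<mu>" using measurable_space[OF T(1) \<omega>] .
    \<comment> \<open>Shifting the environment trades the first summand for one new summand at the end.\<close>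
    have "(\<Sum>i<k. u (Suc i) (T \<omega>)) + u 1 \<omega> = (\<Sum>i<k. u (Suc i) \<omega>) + u (Suc k) \<omega>" for k
      by (induction k) (auto simp: stat'[OF \<omega>])
    from this[of "f _"] have *: "(\<Sum>i<f n. u (Suc i) (T \<omega>)) \<le> (\<Sum>i<f n. u (Suc i) \<omega>) + C \<and>
        (\<Sum>i<f n. u (Suc i) \<omega>) \<le> (\<Sum>i<f n. u (Suc i) (T \<omega>)) + C" for n
      using bd[OF \<omega>, of 0] bd[OF \<omega>, of "f n"] by (smt (verit) One_nat_def)
    have "S n (T \<omega>) \<le> S n \<omega> + C / real n" "S n \<omega> \<le> S n (T \<omega>) + C / real n" for n
      unfolding S_def add_divide_distrib[symmetric] using * by (simp_all add: divide_right_mono)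
    then show ?thesis unfolding Z_def
      by (intro antisym limsup_ennreal_mono_vanishing[where C = C] S0 \<omega> T\<omega> C)
  qed

  have d: "d < c" using d by (simp add: c_def)
  have "AE \<omega> in \<mu>. d < Z \<omega>"
  proof -
    define A where "A = {\<omega> \<in> space \<mu>. Z \<omega> \<le> d}"
    have A: "A \<in> sets \<mu>" unfolding A_def by measurable
    have "T -` A \<inter> space \<mu> = A"
      using inv measurable_space[OF T(1)] by (auto simp: A_def)
    with env A have "emeasure \<mu> A = 0 \<or> emeasure \<mu> (space \<mu> - A) = 0"
      unfolding environment_def ergodic_def T_def by blast
    moreover have False if *: "emeasure \<mu> (space \<mu> - A) = 0"
    proof -
      have "AE \<omega> in \<mu>. Z \<omega> \<le> d"
        by (rule AE_I[OF _ *]) (use A in \<open>auto simp: A_def\<close>)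
      then have "(\<integral>\<^sup>+\<omega>. Z \<omega> \<partial>\<mu>) \<le> (\<integral>\<^sup>+\<omega>. d \<partial>\<mu>)" by (rule nn_integral_mono_AE)
      with mean d show False by (simp add: emeasure_space_1)
    qed
    ultimately have *: "emeasure \<mu> A = 0" by blast
    show ?thesis by (rule AE_I[OF _ *]) (use A in \<open>auto simp: A_def\<close>)
  qed
  then show ?thesis unfolding Z_def S_def f_def .
qed

end

section \<open>Lower bound along a single line of weights\<close>

lemma nn_integral_indicator_weight:
  assumes "1 \<le> i" "1 \<le> j" "0 < a i * b j" "a i * b j < 1"
  shows "(\<integral>\<^sup>+w. indicator {real k..} (w (i, j)) \<partial>quenched_law a b) = ennreal ((a i * b j) ^ k)"
proof -
  interpret G: prob_space "geometric_law (a i * b j)" by (rule prob_space_geometric_law)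
  have ij: "(i, j) \<in> {1..} \<times> {1..}" using assms by simp
  have k: "{real k..} \<in> sets (geometric_law (a i * b j))"
    by (auto simp: sets_restrict_space image_iff intro!: bexI[of _ "{real k..}"])
  have m: "(\<lambda>w. w (i, j)) \<in> PiM ({1..} \<times> {1..}) (\<lambda>(i, j). geometric_law (a i * b j)) \<rightarrow>\<^sub>M geometric_law (a i * b j)"
    using measurable_component_singleton[OF ij, of "\<lambda>(i, j). geometric_law (a i * b j)"] by simp
  have "distr (quenched_law a b) (geometric_law (a i * b j)) (\<lambda>w. w (i, j)) = geometric_law (a i * b j)"
    unfolding quenched_law_def
    using distr_PiM_component[of "{1..} \<times> {1..}" "\<lambda>(i, j). geometric_law (a i * b j)" "(i, j)"] ij
    by (auto simp: prob_space_geometric_law)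
  then have "emeasure (geometric_law (a i * b j)) {real k..}
    = (\<integral>\<^sup>+x. indicator {real k..} x \<partial>distr (quenched_law a b) (geometric_law (a i * b j)) (\<lambda>w. w (i, j)))"
    using k by simp
  also have "\<dots> = (\<integral>\<^sup>+w. indicator {real k..} (w (i, j)) \<partial>quenched_law a b)"
    unfolding quenched_law_def using k by (intro nn_integral_distr[OF m]) auto
  finally show ?thesis
    using geometric_law_tail[OF assms(3,4), of k] by (simp add: G.emeasure_eq_measure)
qed

text \<open>The mean of \<open>min W L\<close> for a geometric \<open>W\<close> with parameter \<open>q\<close>, as the sum of the tail probabilities up to
  \<open>L\<close>.\<close>

definition capped_mean :: "nat \<Rightarrow> real \<Rightarrow> real" where
  "capped_mean L q = (\<Sum>k=1..L. q ^ k)"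

text \<open>For integer \<open>x \<ge> 0\<close> this is \<open>min x L\<close>. As a sum of indicators its mean is read off from the tails, and being
  bounded it admits the reversed Fatou inequality.\<close>

definition cap :: "nat \<Rightarrow> real \<Rightarrow> real" where
  "cap L x = (\<Sum>k=1..L. indicator {real k..} x)"

lemma cap_le: "0 \<le> x \<Longrightarrow> cap L x \<le> x"
proof -
  assume x: "0 \<le> x"
  have "cap L x = real (card ({1..L} \<inter> {k. real k \<le> x}))"
    unfolding cap_def by (simp add: indicator_def sum.If_cases)
  also have "\<dots> \<le> real (card {1..nat \<lfloor>x\<rfloor>})"
    by (intro of_nat_mono card_mono) (auto simp: le_nat_floor)
  also have "\<dots> \<le> x" using x by simp
  finally show ?thesis .
qed

lemma cap_bounds: "0 \<le> cap L x" "cap L x \<le> real L"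
  using sum_bounded_above[of "{1..L}" "\<lambda>k. indicator {real k..} x :: real" 1]
  unfolding cap_def by (auto intro!: sum_nonneg simp: indicator_def)

lemma nn_integral_cap:
  assumes "1 \<le> i" "1 \<le> j" "0 < a i * b j" "a i * b j < 1"
  shows "(\<integral>\<^sup>+w. ennreal (cap L (w (i, j))) \<partial>quenched_law a b) = ennreal (capped_mean L (a i * b j))"
proof -
  have [measurable]: "(\<lambda>w. w (i, j)) \<in> borel_measurable (quenched_law a b)"
    unfolding measurable_cong_sets[OF sets_quenched_law refl] by (rule measurable_weight) fact+
  have "(\<integral>\<^sup>+w. ennreal (cap L (w (i, j))) \<partial>quenched_law a b)
    = (\<integral>\<^sup>+w. (\<Sum>k=1..L. indicator {real k..} (w (i, j))) \<partial>quenched_law a b)"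
    unfolding cap_def by (intro nn_integral_cong) (simp add: ennreal_indicator flip: sum_ennreal)
  also have "\<dots> = (\<Sum>k=1..L. \<integral>\<^sup>+w. indicator {real k..} (w (i, j)) \<partial>quenched_law a b)"
    by (rule nn_integral_sum) measurable
  also have "\<dots> = (\<Sum>k=1..L. ennreal ((a i * b j) ^ k))"
    by (simp only: nn_integral_indicator_weight[where a = a and b = b, OF assms])
  also have "\<dots> = ennreal (capped_mean L (a i * b j))"
    unfolding capped_mean_def using assms(3) by (intro sum_ennreal) auto
  finally show ?thesis .
qed

lemma nn_integral_le_of_tendsto:
  fixes f :: "nat \<Rightarrow> 'a \<Rightarrow> ennreal"
  assumes [measurable]: "\<And>n. f n \<in> borel_measurable M"
    and lim: "\<And>x. x \<in> space M \<Longrightarrow> (\<lambda>n. f n x) \<longlonglongrightarrow> h x"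
    and c: "c < \<top>" and le: "\<And>n. c * (\<integral>\<^sup>+x. f n x \<partial>M) \<le> K"
  shows "c * (\<integral>\<^sup>+x. h x \<partial>M) \<le> K"
proof -
  have "c * (\<integral>\<^sup>+x. h x \<partial>M) = c * (\<integral>\<^sup>+x. liminf (\<lambda>n. f n x) \<partial>M)"
    using lim_imp_Liminf[OF sequentially_bot lim] by (auto intro!: arg_cong[where f = "(*) c"] nn_integral_cong)
  also have "\<dots> = (\<integral>\<^sup>+x. c * liminf (\<lambda>n. f n x) \<partial>M)"
    by (rule nn_integral_cmult[symmetric]) measurable
  also have "\<dots> = (\<integral>\<^sup>+x. liminf (\<lambda>n. c * f n x) \<partial>M)"
    using lim_imp_Liminf[OF sequentially_bot lim] lim_imp_Liminf[OF sequentially_bot ennreal_tendsto_cmult[OF c lim]]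
    by (auto intro!: nn_integral_cong)
  also have "\<dots> \<le> liminf (\<lambda>n. \<integral>\<^sup>+x. c * f n x \<partial>M)"
    by (rule nn_integral_liminf) measurable
  also have "\<dots> = liminf (\<lambda>n. c * (\<integral>\<^sup>+x. f n x \<partial>M))"
    by (simp add: nn_integral_cmult)
  also have "\<dots> \<le> liminf (\<lambda>n. K)"
    by (intro Liminf_mono always_eventually allI le)
  finally show ?thesis by (simp add: Liminf_const)
qed

context random_environment
begin

text \<open>The cells \<open>cell i\<close> form a row or a column. Their weights have parameters \<open>u\<^sub>i v\<close> in which \<open>u\<close> varies along the line and \<open>v\<close>
  belongs to the line itself. Given the environment, the reversed Fatou inequality bounds the deterministic
  number \<open>g s t\<close> from below by the upper limit of the averages of the capped means. Where \<open>v > c\<close>, these exceed the capped means with \<open>c\<close>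
  in place of \<open>v\<close>, whose averages are controlled by ergodicity. As \<open>v > c\<close> is not a null event, the
  two bounds meet in at least one environment.\<close>

lemma shape_ge_line_capped:
  fixes u :: "nat \<Rightarrow> (nat \<Rightarrow> real) \<times> (nat \<Rightarrow> real) \<Rightarrow> real" and v :: "(nat \<Rightarrow> real) \<times> (nat \<Rightarrow> real) \<Rightarrow> real"
    and cell :: "nat \<Rightarrow> nat \<times> nat"
  assumes g: "shape_function \<mu> g" and s: "0 < s" and t: "0 < t" and r: "0 < r"
    and cell: "\<And>i. 1 \<le> fst (cell i)" "\<And>i. 1 \<le> snd (cell i)"
    and param: "\<And>i \<omega>. fst \<omega> (fst (cell i)) * snd \<omega> (snd (cell i)) = u (Suc i) \<omega> * v \<omega>"
    and u [measurable]: "\<And>i. u (Suc i) \<in> borel_measurable \<mu>"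
    and v [measurable]: "v \<in> borel_measurable \<mu>"
    and stat: "\<And>i \<omega>. \<omega> \<in> space \<mu> \<Longrightarrow> u (Suc i) (map_prod (shift 1) (shift 1) \<omega>) = u (Suc (Suc i)) \<omega>"
    and ubd: "\<And>i \<omega>. \<omega> \<in> space \<mu> \<Longrightarrow> 0 < u (Suc i) \<omega> \<and> u (Suc i) \<omega> < 1"
    and vbd: "\<And>\<omega>. \<omega> \<in> space \<mu> \<Longrightarrow> 0 < v \<omega> \<and> v \<omega> < 1"
    and lp: "\<And>w n. \<lbrakk>\<forall>i\<ge>1. \<forall>j\<ge>1. 0 \<le> w (i, j); 1 \<le> nat \<lfloor>real n * s\<rfloor>; 1 \<le> nat \<lfloor>real n * t\<rfloor>\<rbrakk>
      \<Longrightarrow> (\<Sum>i<nat \<lfloor>real n * r\<rfloor>. w (cell i)) \<le> last_passage w (nat \<lfloor>real n * s\<rfloor>) (nat \<lfloor>real n * t\<rfloor>)"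
    and c: "0 < c" "c < 1" and top: "\<not> (AE \<omega> in \<mu>. v \<omega> \<le> c)"
  shows "ennreal r * (\<integral>\<^sup>+\<omega>. ennreal (capped_mean L (u 1 \<omega> * c)) \<partial>\<mu>) \<le> g s t"
proof (rule dense_le)
  fix d assume d: "d < ennreal r * (\<integral>\<^sup>+\<omega>. ennreal (capped_mean L (u 1 \<omega> * c)) \<partial>\<mu>)"
  define f where "f n = nat \<lfloor>real n * r\<rfloor>" for n
  define X where "X n w = ennreal ((\<Sum>i<f n. cap L (w (cell i))) / real n)" for n w
  have capm [measurable]: "cap L \<in> borel_measurable borel" unfolding cap_def by measurable
  have wm [measurable]: "(\<lambda>w. w (cell i)) \<in> borel_measurable weight_space" for i
    using measurable_weight[OF cell(1)[of i] cell(2)[of i]] by simp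
  have Xm [measurable]: "X n \<in> borel_measurable weight_space" for n
    unfolding X_def by measurable
  have fr: "real (f n) / real n \<le> r" for n
    using r by (cases "n = 0") (auto simp: f_def field_simps)

  have "AE w in annealed_law \<mu>. limsup (\<lambda>n. X n w) \<le> g s t"
  proof -
    have "AE w in annealed_law \<mu>. \<forall>s>0. \<forall>t>0.
        (\<lambda>n. ennreal (last_passage w (nat \<lfloor>real n * s\<rfloor>) (nat \<lfloor>real n * t\<rfloor>) / real n)) \<longlonglongrightarrow> g s t"
      using g unfolding shape_function_def .
    then show ?thesis
    proof (rule AE_mp, intro AE_I2 impI)
      fix w assume "w \<in> space (annealed_law \<mu>)"
      then have "w \<in> space weight_space" using sets_eq_imp_space_eq[OF sets_annealed] by simp
      then have w0: "0 \<le> w (i, j)" if "1 \<le> i" "1 \<le> j" for i j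
        using that by (auto simp: space_PiM space_restrict_space PiE_iff)
      assume "\<forall>s>0. \<forall>t>0.
        (\<lambda>n. ennreal (last_passage w (nat \<lfloor>real n * s\<rfloor>) (nat \<lfloor>real n * t\<rfloor>) / real n)) \<longlonglongrightarrow> g s t"
      then have lim: "(\<lambda>n. ennreal (last_passage w (nat \<lfloor>real n * s\<rfloor>) (nat \<lfloor>real n * t\<rfloor>) / real n)) \<longlonglongrightarrow> g s t"
        using s t by blast
      obtain N where N: "1 / s < real N" "1 / t < real N"
        by (metis max_less_iff_conj reals_Archimedean2)
      have "limsup (\<lambda>n. X n w) \<le> limsup (\<lambda>n. ennreal (last_passage w (nat \<lfloor>real n * s\<rfloor>) (nat \<lfloor>real n * t\<rfloor>) / real n))"
      proof (rule Limsup_mono, rule eventually_sequentiallyI)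
        fix n assume n: "N \<le> n"
        have big: "1 \<le> nat \<lfloor>real n * x\<rfloor>" if "0 < x" "1 / x < real N" for x
        proof -
          have "1 / x < real n" using that n by linarith
          then have "1 \<le> real n * x" using that by (simp add: field_simps)
          then show ?thesis by linarith
        qed
        have "(\<Sum>i<f n. cap L (w (cell i))) \<le> (\<Sum>i<f n. w (cell i))"
          by (intro sum_mono cap_le) (metis w0 cell prod.collapse)
        also have "\<dots> \<le> last_passage w (nat \<lfloor>real n * s\<rfloor>) (nat \<lfloor>real n * t\<rfloor>)"
          unfolding f_def using w0 by (intro lp big s t N) auto
        finally show "X n w \<le> ennreal (last_passage w (nat \<lfloor>real n * s\<rfloor>) (nat \<lfloor>real n * t\<rfloor>) / real n)"
          unfolding X_def by (intro ennreal_leI divide_right_mono) auto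
      qed
      also have "\<dots> = g s t" using lim by (simp add: lim_imp_Limsup)
      finally show "limsup (\<lambda>n. X n w) \<le> g s t" .
    qed
  qed
  moreover have "(AE w in annealed_law \<mu>. limsup (\<lambda>n. X n w) \<le> g s t) \<longleftrightarrow>
      (AE \<omega> in \<mu>. AE w in quenched_law (fst \<omega>) (snd \<omega>). limsup (\<lambda>n. X n w) \<le> g s t)"
  proof -
    have [measurable]: "(\<lambda>w. limsup (\<lambda>n. X n w)) \<in> borel_measurable weight_space"
      by (rule borel_measurable_limsup) (rule Xm)
    note Z = this
    have "Measurable.pred weight_space (\<lambda>w. limsup (\<lambda>n. X n w) \<le> g s t)"
      unfolding Measurable.pred_def by (rule borel_measurable_le[OF Z borel_measurable_const])
    from AE_bind[OF measurable_quenched this] show ?thesis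
      unfolding annealed_law_def case_prod_unfold .
  qed
  ultimately have "AE \<omega> in \<mu>. AE w in quenched_law (fst \<omega>) (snd \<omega>). limsup (\<lambda>n. X n w) \<le> g s t"
    by blast
  then have quenched: "AE \<omega> in \<mu>. limsup (\<lambda>n. ennreal ((\<Sum>i<f n. capped_mean L (u (Suc i) \<omega> * v \<omega>)) / real n)) \<le> g s t"
  proof (rule AE_mp, intro AE_I2 impI)
    fix \<omega> assume \<omega>: "\<omega> \<in> space \<mu>"
      and AE: "AE w in quenched_law (fst \<omega>) (snd \<omega>). limsup (\<lambda>n. X n w) \<le> g s t"
    let ?Q = "quenched_law (fst \<omega>) (snd \<omega>)"
    interpret Q: prob_space ?Q by (rule prob_space_quenched_law)
    note [measurable_cong] = sets_quenched_law[of "fst \<omega>" "snd \<omega>"]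
    have q: "0 < fst \<omega> (fst (cell i)) * snd \<omega> (snd (cell i))" "fst \<omega> (fst (cell i)) * snd \<omega> (snd (cell i)) < 1" for i
      using ubd[OF \<omega>, of i] vbd[OF \<omega>] mult_strict_mono[of "u (Suc i) \<omega>" 1 "v \<omega>" 1] by (auto simp: param)
    have "ennreal ((\<Sum>i<f n. capped_mean L (u (Suc i) \<omega> * v \<omega>)) / real n) = (\<integral>\<^sup>+w. X n w \<partial>?Q)" for n
    proof -
      have "(\<integral>\<^sup>+w. X n w \<partial>?Q) = (\<integral>\<^sup>+w. ennreal (1 / real n) * (\<Sum>i<f n. ennreal (cap L (w (cell i)))) \<partial>?Q)"
        by (intro nn_integral_cong) (simp add: X_def cap_bounds sum_nonneg flip: ennreal_mult)
      also have "\<dots> = ennreal (1 / real n) * (\<Sum>i<f n. \<integral>\<^sup>+w. ennreal (cap L (w (cell i))) \<partial>?Q)"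
        by (simp add: nn_integral_cmult nn_integral_sum del: sum_ennreal)
      also have "\<dots> = ennreal (1 / real n) * (\<Sum>i<f n. ennreal (capped_mean L (u (Suc i) \<omega> * v \<omega>)))"
      proof -
        have "(\<integral>\<^sup>+w. ennreal (cap L (w (cell i))) \<partial>?Q) = ennreal (capped_mean L (u (Suc i) \<omega> * v \<omega>))" for i
          using nn_integral_cap[where a = "fst \<omega>" and b = "snd \<omega>", OF cell(1)[of i] cell(2)[of i] q[of i]]
          by (simp add: param)
        then show ?thesis by simp
      qed
      also have "\<dots> = ennreal ((\<Sum>i<f n. capped_mean L (u (Suc i) \<omega> * v \<omega>)) / real n)"
      proof -
        have "0 \<le> capped_mean L (u (Suc i) \<omega> * v \<omega>)" for i
          using q[of i] unfolding capped_mean_def param by (intro sum_nonneg) simp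
        then show ?thesis by (simp add: sum_nonneg flip: ennreal_mult)
      qed
      finally show ?thesis ..
    qed
    then have "limsup (\<lambda>n. ennreal ((\<Sum>i<f n. capped_mean L (u (Suc i) \<omega> * v \<omega>)) / real n))
      = limsup (\<lambda>n. \<integral>\<^sup>+w. X n w \<partial>?Q)" by simp
    also have "\<dots> \<le> (\<integral>\<^sup>+w. limsup (\<lambda>n. X n w) \<partial>?Q)"
    proof (rule nn_integral_limsup)
      fix n
      show "AE w in ?Q. X n w \<le> ennreal (r * real L)"
      proof (rule AE_I2)
        fix w
        have "(\<Sum>i<f n. cap L (w (cell i))) \<le> real (f n) * real L"
          using sum_bounded_above[of "{..<f n}" "\<lambda>i. cap L (w (cell i))" "real L"] cap_bounds by simp
        then have "(\<Sum>i<f n. cap L (w (cell i))) / real n \<le> real (f n) / real n * real L"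
          by (simp add: divide_right_mono)
        also have "\<dots> \<le> r * real L" by (intro mult_right_mono fr) simp
        finally show "X n w \<le> ennreal (r * real L)" unfolding X_def by (rule ennreal_leI)
      qed
    qed (auto simp: Q.emeasure_space_1)
    also have "\<dots> \<le> (\<integral>\<^sup>+w. g s t \<partial>?Q)" by (rule nn_integral_mono_AE[OF AE])
    also have "\<dots> = g s t" by (simp add: Q.emeasure_space_1)
    finally show "limsup (\<lambda>n. ennreal ((\<Sum>i<f n. capped_mean L (u (Suc i) \<omega> * v \<omega>)) / real n)) \<le> g s t" .
  qed

  have "AE \<omega> in \<mu>. d < limsup (\<lambda>n. ennreal ((\<Sum>i<f n. capped_mean L (u (Suc i) \<omega> * c)) / real n))"
    unfolding f_def
  proof (rule limsup_average_ge[where u = "\<lambda>i \<omega>. capped_mean L (u i \<omega> * c)" and C = "real L"])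
    show "(\<lambda>\<omega>. capped_mean L (u (Suc i) \<omega> * c)) \<in> borel_measurable \<mu>" for i
      unfolding capped_mean_def by measurable
    show "0 \<le> capped_mean L (u (Suc i) \<omega> * c) \<and> capped_mean L (u (Suc i) \<omega> * c) \<le> real L" if "\<omega> \<in> space \<mu>" for i \<omega>
    proof -
      have "0 \<le> u (Suc i) \<omega> * c" "u (Suc i) \<omega> * c \<le> 1"
        using ubd[OF that, of i] c by (auto intro: mult_le_one)
      then show ?thesis
        using sum_bounded_above[of "{1..L}" "\<lambda>k. (u (Suc i) \<omega> * c) ^ k" 1]
        unfolding capped_mean_def by (auto intro!: sum_nonneg power_le_one)
    qed
  qed (use stat r d in auto)
  note ergodic = this
  show "d \<le> g s t"
  proof (rule ccontr)
    assume "\<not> d \<le> g s t"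
    have "AE \<omega> in \<mu>. v \<omega> \<le> c"
      using quenched ergodic AE_space
    proof eventually_elim
      case (elim \<omega>)
      show "v \<omega> \<le> c"
      proof (rule ccontr)
        assume "\<not> v \<omega> \<le> c"
        then have "capped_mean L (u (Suc i) \<omega> * c) \<le> capped_mean L (u (Suc i) \<omega> * v \<omega>)" for i
          unfolding capped_mean_def using ubd[OF elim(3), of i] c
          by (intro sum_mono power_mono mult_left_mono) auto
        then have "limsup (\<lambda>n. ennreal ((\<Sum>i<f n. capped_mean L (u (Suc i) \<omega> * c)) / real n))
          \<le> limsup (\<lambda>n. ennreal ((\<Sum>i<f n. capped_mean L (u (Suc i) \<omega> * v \<omega>)) / real n))"
          by (intro Limsup_mono always_eventually allI ennreal_leI divide_right_mono sum_mono) auto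
        with elim \<open>\<not> d \<le> g s t\<close> show False by auto
      qed
    qed
    with top show False by contradiction
  qed
qed

text \<open>The cap \<open>L\<close> is removed first, then \<open>c\<close> tends to \<open>1\<close>; both limits go through the integral by Fatou's
  lemma.\<close>

lemma shape_ge_line:
  fixes u :: "nat \<Rightarrow> (nat \<Rightarrow> real) \<times> (nat \<Rightarrow> real) \<Rightarrow> real" and v :: "(nat \<Rightarrow> real) \<times> (nat \<Rightarrow> real) \<Rightarrow> real"
    and cell :: "nat \<Rightarrow> nat \<times> nat"
  assumes g: "shape_function \<mu> g" and s: "0 < s" and t: "0 < t" and r: "0 < r"
    and cell: "\<And>i. 1 \<le> fst (cell i)" "\<And>i. 1 \<le> snd (cell i)"
    and param: "\<And>i \<omega>. fst \<omega> (fst (cell i)) * snd \<omega> (snd (cell i)) = u (Suc i) \<omega> * v \<omega>"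
    and u [measurable]: "\<And>i. u (Suc i) \<in> borel_measurable \<mu>"
    and v [measurable]: "v \<in> borel_measurable \<mu>"
    and stat: "\<And>i \<omega>. \<omega> \<in> space \<mu> \<Longrightarrow> u (Suc i) (map_prod (shift 1) (shift 1) \<omega>) = u (Suc (Suc i)) \<omega>"
    and ubd: "\<And>i \<omega>. \<omega> \<in> space \<mu> \<Longrightarrow> 0 < u (Suc i) \<omega> \<and> u (Suc i) \<omega> < 1"
    and vbd: "\<And>\<omega>. \<omega> \<in> space \<mu> \<Longrightarrow> 0 < v \<omega> \<and> v \<omega> < 1"
    and lp: "\<And>w n. \<lbrakk>\<forall>i\<ge>1. \<forall>j\<ge>1. 0 \<le> w (i, j); 1 \<le> nat \<lfloor>real n * s\<rfloor>; 1 \<le> nat \<lfloor>real n * t\<rfloor>\<rbrakk>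
      \<Longrightarrow> (\<Sum>i<nat \<lfloor>real n * r\<rfloor>. w (cell i)) \<le> last_passage w (nat \<lfloor>real n * s\<rfloor>) (nat \<lfloor>real n * t\<rfloor>)"
    and top: "\<And>c. 0 < c \<Longrightarrow> c < 1 \<Longrightarrow> \<not> (AE \<omega> in \<mu>. v \<omega> \<le> c)"
  shows "ennreal r * (\<integral>\<^sup>+\<omega>. ennreal (u 1 \<omega> / (1 - u 1 \<omega>)) \<partial>\<mu>) \<le> g s t"
proof -
  have u1 [measurable]: "u 1 \<in> borel_measurable \<mu>" using u[of 0] by simp
  have u1bd: "0 < u 1 \<omega>" "u 1 \<omega> < 1" if "\<omega> \<in> space \<mu>" for \<omega>
    using ubd[OF that, of 0] by auto
  have *: "ennreal r * (\<integral>\<^sup>+\<omega>. ennreal (u 1 \<omega> * c / (1 - u 1 \<omega> * c)) \<partial>\<mu>) \<le> g s t" if c: "0 < c" "c < 1" for c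
  proof (rule nn_integral_le_of_tendsto)
    show "ennreal r * (\<integral>\<^sup>+\<omega>. ennreal (capped_mean L (u 1 \<omega> * c)) \<partial>\<mu>) \<le> g s t" for L
      by (rule shape_ge_line_capped[where v = v and cell = cell]) (fact assms c top[OF c])+
    show "(\<lambda>\<omega>. ennreal (capped_mean L (u 1 \<omega> * c))) \<in> borel_measurable \<mu>" for L
      unfolding capped_mean_def by measurable
    fix \<omega> assume "\<omega> \<in> space \<mu>"
    note q = u1bd[OF this]
    define q where "q = u 1 \<omega> * c"
    have q: "0 < q" "q < 1" using q c mult_strict_mono[of "u 1 \<omega>" 1 c 1] by (auto simp: q_def)
    have "(\<lambda>n. q ^ n) sums (1 / (1 - q))" using q by (intro geometric_sums) auto
    then have "(\<lambda>n. q * q ^ n) sums (q * (1 / (1 - q)))" by (rule sums_mult)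
    moreover have "(\<Sum>n<L. q * q ^ n) = capped_mean L q" for L
      unfolding capped_mean_def by (induction L) auto
    ultimately have "(\<lambda>L. capped_mean L q) \<longlonglongrightarrow> q / (1 - q)" by (simp add: sums_def)
    then show "(\<lambda>L. ennreal (capped_mean L (u 1 \<omega> * c))) \<longlonglongrightarrow> ennreal (u 1 \<omega> * c / (1 - u 1 \<omega> * c))"
      unfolding q_def[symmetric] by (rule tendsto_ennrealI)
  qed simp
  show ?thesis
  proof (rule nn_integral_le_of_tendsto)
    define c where "c n = 1 - 1 / real (n + 2)" for n
    have c: "0 < c n" "c n < 1" for n by (auto simp: c_def)
    show "ennreal r * (\<integral>\<^sup>+\<omega>. ennreal (u 1 \<omega> * c n / (1 - u 1 \<omega> * c n)) \<partial>\<mu>) \<le> g s t" for n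
      by (rule *[OF c])
    show "(\<lambda>\<omega>. ennreal (u 1 \<omega> * c n / (1 - u 1 \<omega> * c n))) \<in> borel_measurable \<mu>" for n
      by measurable
    have "(\<lambda>n. 1 - 1 / real (n + 2)) \<longlonglongrightarrow> 1 - 0"
      by (intro tendsto_diff tendsto_const LIMSEQ_ignore_initial_segment lim_1_over_n)
    then have lim: "c \<longlonglongrightarrow> 1" unfolding c_def by simp
    fix \<omega> assume "\<omega> \<in> space \<mu>"
    then have "u 1 \<omega> \<noteq> 1" using u1bd[of \<omega>] by simp
    then have "(\<lambda>n. u 1 \<omega> * c n / (1 - u 1 \<omega> * c n)) \<longlonglongrightarrow> u 1 \<omega> * 1 / (1 - u 1 \<omega> * 1)"
      by (intro tendsto_intros lim) auto
    then show "(\<lambda>n. ennreal (u 1 \<omega> * c n / (1 - u 1 \<omega> * c n))) \<longlonglongrightarrow> ennreal (u 1 \<omega> / (1 - u 1 \<omega>))"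
      by (intro tendsto_ennrealI) simp
  qed simp
qed

end

section \<open>Superadditivity of the shape function\<close>

lemma measurable_shift_weights [measurable]:
  "shift_weights m n \<in> weight_space \<rightarrow>\<^sub>M weight_space"
proof (rule measurable_restrict)
  fix x :: "nat \<times> nat" assume "x \<in> {1..} \<times> {1..}"
  then have "(fst x + m, snd x + n) \<in> {1..} \<times> {1..}" by auto
  then show "(\<lambda>w. w (fst x + m, snd x + n)) \<in> weight_space \<rightarrow>\<^sub>M restrict_space borel {0..}"
    by (rule measurable_component_singleton)
qed

lemma distr_quenched_shift:
  "distr (quenched_law a b) weight_space (shift_weights m n) = quenched_law (shift m a) (shift n b)"
proof -
  let ?M = "\<lambda>x :: nat \<times> nat. case x of (i, j) \<Rightarrow> geometric_law (a i * b j)"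
  let ?t = "\<lambda>x :: nat \<times> nat. (fst x + m, snd x + n)"
  have "distr (quenched_law a b) weight_space (shift_weights m n)
    = distr (PiM ({1..} \<times> {1..}) ?M) (PiM ({1..} \<times> {1..}) (\<lambda>x. ?M (?t x))) (\<lambda>w. \<lambda>x\<in>{1..} \<times> {1..}. w (?t x))"
    unfolding quenched_law_def
    by (intro distr_cong refl sets_PiM_cong) (auto split: prod.splits)
  also have "\<dots> = PiM ({1..} \<times> {1..}) (\<lambda>x. ?M (?t x))"
    by (rule distr_PiM_reindex) (auto simp: prob_space_geometric_law inj_on_def split: prod.splits)
  also have "\<dots> = quenched_law (shift m a) (shift n b)"
    unfolding quenched_law_def by (intro PiM_cong refl) (auto simp: shift_apply)
  finally show ?thesis .
qed

context random_environment
begin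

text \<open>Shifting the weights amounts to shifting the two parameter sequences, under which \<open>\<mu>\<close> is invariant.\<close>

lemma distr_annealed_shift:
  assumes "1 \<le> m" "1 \<le> n"
  shows "distr (annealed_law \<mu>) weight_space (shift_weights m n) = annealed_law \<mu>"
proof -
  let ?T = "map_prod (shift m) (shift n)" and ?K = "\<lambda>(a, b). quenched_law a b"
  have "distr (annealed_law \<mu>) weight_space (shift_weights m n)
    = \<mu> \<bind> (\<lambda>\<omega>. distr (?K \<omega>) weight_space (shift_weights m n))"
    unfolding annealed_law_def
    by (rule distr_bind[OF measurable_quenched not_empty measurable_shift_weights])
  also have "\<dots> = \<mu> \<bind> (\<lambda>\<omega>. ?K (?T \<omega>))"
    by (simp only: case_prod_unfold distr_quenched_shift fst_map_prod snd_map_prod)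
  also have "\<dots> = distr \<mu> \<mu> ?T \<bind> ?K"
    by (rule bind_distr[OF shift_invariant(1)[OF assms] measurable_quenched not_empty, symmetric])
  finally show ?thesis unfolding shift_invariant(2)[OF assms] annealed_law_def .
qed

end

lemma (in prob_space) prob_tendsto_0_of_AE:
  assumes E [measurable]: "\<And>n. E n \<in> events" and AE: "AE x in M. eventually (\<lambda>n. x \<notin> E n) sequentially"
  shows "(\<lambda>n. prob (E n)) \<longlonglongrightarrow> 0"
proof -
  have "(\<lambda>n. \<integral>x. (indicator (E n) x :: real) \<partial>M) \<longlonglongrightarrow> (\<integral>x. (0 :: real) \<partial>M)"
  proof (intro integral_dominated_convergence[where w = "\<lambda>_. 1"])
    show "AE x in M. (\<lambda>n. indicator (E n) x :: real) \<longlonglongrightarrow> 0"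
      using AE by eventually_elim (auto intro!: tendsto_eventually elim!: eventually_mono)
  qed (auto simp: indicator_def)
  then show ?thesis by simp
qed

text \<open>The alternative \<open>c = 0\<close> covers the summand \<open>0\<close>, which has no strict lower bound.\<close>

lemma ennreal_add_le_of_approx:
  fixes x y z :: ennreal
  assumes "\<And>c d. (c < x \<or> c = 0) \<Longrightarrow> (d < y \<or> d = 0) \<Longrightarrow> c + d \<le> z"
  shows "x + y \<le> z"
proof -
  have app: "\<exists>f. (\<forall>n. f n < x \<or> f n = 0) \<and> f \<longlonglongrightarrow> x" for x :: ennreal
  proof (cases "x = 0")
    case False
    then have "0 < x" by (simp add: zero_less_iff_neq_zero)
    from approx_from_below_dense_linorder[OF this] show ?thesis by blast
  qed auto
  from app[of x] app[of y] obtain f h where f: "\<forall>n. f n < x \<or> f n = 0" "f \<longlonglongrightarrow> x"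
    and h: "\<forall>n. h n < y \<or> h n = 0" "h \<longlonglongrightarrow> y" by blast
  have "(\<lambda>n. f n + h n) \<longlonglongrightarrow> x + y"
    using f(2) h(2) by (rule tendsto_add)
  then show ?thesis
    by (rule LIMSEQ_le_const2) (use assms f(1) h(1) in blast)
qed

context random_environment
begin

text \<open>Almost sure convergence of the passage times from the corner is not directly available from the moving starting
  points \<open>(\<lfloor>ns\<rfloor>,\<lfloor>nt\<rfloor>)\<close>, but their laws are the same by stationarity. So convergence in probability carries over:
  if the claim failed, then for large \<open>n\<close> three events of small probability would cover the whole space.\<close>

lemma shape_superadditive:
  assumes g: "shape_function \<mu> g" and pos: "0 < s" "0 < t" "0 < s'" "0 < t'"
  shows "g s t + g s' t' \<le> g (s + s') (t + t')"
proof (rule ennreal_add_le_of_approx, rule ccontr)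
  fix c d assume c: "c < g s t \<or> c = 0" and d: "d < g s' t' \<or> d = 0"
    and contr: "\<not> c + d \<le> g (s + s') (t + t')"
  interpret P: prob_space "annealed_law \<mu>" by (rule prob_space_annealed)
  define X where "X s t n w = ennreal (last_passage w (nat \<lfloor>real n * s\<rfloor>) (nat \<lfloor>real n * t\<rfloor>) / real n)" for s t n w
  have Xm [measurable]: "X s t n \<in> borel_measurable weight_space" for s t n unfolding X_def by measurable
  have Xm' [measurable]: "X s t n \<in> borel_measurable (annealed_law \<mu>)" for s t n
    unfolding measurable_cong_sets[OF sets_annealed refl] by (rule Xm)
  have lim: "AE w in annealed_law \<mu>. (\<lambda>n. X s t n w) \<longlonglongrightarrow> g s t" if "0 < s" "0 < t" for s t
    using g unfolding shape_function_def by eventually_elim (use that in \<open>auto simp: X_def\<close>)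
  \<comment> \<open>The first passage is too short, the second is too short, the whole passage is too long.\<close>
  define A where "A n = {w \<in> space (annealed_law \<mu>). X s t n w < c}" for n
  define B where "B n = {w \<in> space (annealed_law \<mu>). X s' t' n w < d}" for n
  define C where "C n = {w \<in> space (annealed_law \<mu>). c + d \<le> X (s + s') (t + t') n w}" for n
  have ABC [measurable]: "A n \<in> P.events" "B n \<in> P.events" "C n \<in> P.events" for n
    unfolding A_def B_def C_def by measurable
  have "(\<lambda>n. P.prob (A n)) \<longlonglongrightarrow> 0"
  proof (rule P.prob_tendsto_0_of_AE)
    show "AE w in annealed_law \<mu>. \<forall>\<^sub>F n in sequentially. w \<notin> A n"
      using lim[OF pos(1,2)]
    proof eventually_elim
      case (elim w)
      from c show ?case
      proof
        assume "c < g s t"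
        from order_tendstoD(1)[OF elim this] show ?thesis by eventually_elim (auto simp: A_def)
      qed (auto simp: A_def)
    qed
  qed measurable
  moreover have "(\<lambda>n. P.prob (B n)) \<longlonglongrightarrow> 0"
  proof (rule P.prob_tendsto_0_of_AE)
    show "AE w in annealed_law \<mu>. \<forall>\<^sub>F n in sequentially. w \<notin> B n"
      using lim[OF pos(3,4)]
    proof eventually_elim
      case (elim w)
      from d show ?case
      proof
        assume "d < g s' t'"
        from order_tendstoD(1)[OF elim this] show ?thesis by eventually_elim (auto simp: B_def)
      qed (auto simp: B_def)
    qed
  qed measurable
  moreover have "(\<lambda>n. P.prob (C n)) \<longlonglongrightarrow> 0"
  proof (rule P.prob_tendsto_0_of_AE)
    have "AE w in annealed_law \<mu>. (\<lambda>n. X (s + s') (t + t') n w) \<longlonglongrightarrow> g (s + s') (t + t')"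
      using lim pos by simp
    then show "AE w in annealed_law \<mu>. \<forall>\<^sub>F n in sequentially. w \<notin> C n"
    proof eventually_elim
      case (elim w)
      have "g (s + s') (t + t') < c + d" using contr by simp
      from order_tendstoD(2)[OF elim this] show ?case by eventually_elim (auto simp: C_def)
    qed
  qed measurable
  ultimately have "(\<lambda>n. P.prob (A n) + P.prob (B n) + P.prob (C n)) \<longlonglongrightarrow> 0 + 0 + 0"
    by (intro tendsto_add)
  then have "eventually (\<lambda>n. P.prob (A n) + P.prob (B n) + P.prob (C n) < 1) sequentially"
    by (rule order_tendstoD(2)) simp
  then obtain N where N: "\<And>n. N \<le> n \<Longrightarrow> P.prob (A n) + P.prob (B n) + P.prob (C n) < 1"
    by (auto simp: eventually_sequentially)
  obtain M where M: "1 / s < real M" "1 / t < real M"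
    by (metis max_less_iff_conj reals_Archimedean2)
  define n where "n = max N M"
  have big: "1 \<le> nat \<lfloor>real n * x\<rfloor>" if "0 < x" "1 / x < real M" for x
  proof -
    have "1 / x < real n" using that by (simp add: n_def)
    then have "1 \<le> real n * x" using that by (simp add: field_simps)
    then show ?thesis by linarith
  qed
  define k where "k = nat \<lfloor>real n * s\<rfloor>"
  define l where "l = nat \<lfloor>real n * t\<rfloor>"
  have kl: "1 \<le> k" "1 \<le> l" unfolding k_def l_def using big pos M by auto
  define B' where "B' = shift_weights k l -` B n \<inter> space (annealed_law \<mu>)"
  have th: "shift_weights k l \<in> annealed_law \<mu> \<rightarrow>\<^sub>M weight_space"
    unfolding measurable_cong_sets[OF sets_annealed refl] by (rule measurable_shift_weights)
  have "P.prob (B n) = measure (distr (annealed_law \<mu>) weight_space (shift_weights k l)) (B n)"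
    unfolding distr_annealed_shift[OF kl] ..
  also have "\<dots> = P.prob B'"
    unfolding B'_def by (rule measure_distr[OF th]) (use ABC(2) sets_annealed in simp)
  finally have B': "P.prob (B n) = P.prob B'" .
  have B'm: "B' \<in> P.events"
    unfolding B'_def by (rule measurable_sets[OF th]) (use ABC(2) sets_annealed in simp)
  have "space (annealed_law \<mu>) \<subseteq> A n \<union> B' \<union> C n"
  proof
    fix w assume w: "w \<in> space (annealed_law \<mu>)"
    then have w': "w \<in> space weight_space" using sets_eq_imp_space_eq[OF sets_annealed] by simp
    note w0 = weight_space_nonneg[OF w']
    define w2 where "w2 = shift_weights k l w"
    have w2: "w2 \<in> space (annealed_law \<mu>)" "w2 \<in> space weight_space"
      using measurable_space[OF measurable_shift_weights w', of k l] sets_eq_imp_space_eq[OF sets_annealed]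
      by (auto simp: w2_def)
    have lp0: "0 \<le> last_passage v i j" if "v \<in> space weight_space" for v i j
      by (rule last_passage_nonneg[OF weight_space_nonneg[OF that]])
    have "last_passage w k l + last_passage w2 (nat \<lfloor>real n * s'\<rfloor>) (nat \<lfloor>real n * t'\<rfloor>)
      \<le> last_passage w (k + nat \<lfloor>real n * s'\<rfloor>) (l + nat \<lfloor>real n * t'\<rfloor>)"
      unfolding w2_def by (rule last_passage_superadditive) (rule w0)
    also have "\<dots> \<le> last_passage w (nat \<lfloor>real n * (s + s')\<rfloor>) (nat \<lfloor>real n * (t + t')\<rfloor>)"
    proof (rule last_passage_mono[OF w0])
      have fl: "nat \<lfloor>real n * x\<rfloor> + nat \<lfloor>real n * y\<rfloor> \<le> nat \<lfloor>real n * (x + y)\<rfloor>" if "0 < x" "0 < y" for x y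
      proof -
        have "0 \<le> real n * x" "0 \<le> real n * y" using that by auto
        then show ?thesis unfolding distrib_left by linarith
      qed
      show "k + nat \<lfloor>real n * s'\<rfloor> \<le> nat \<lfloor>real n * (s + s')\<rfloor>" "l + nat \<lfloor>real n * t'\<rfloor> \<le> nat \<lfloor>real n * (t + t')\<rfloor>"
        unfolding k_def l_def using fl pos by auto
    qed
    finally have lp: "last_passage w k l + last_passage w2 (nat \<lfloor>real n * s'\<rfloor>) (nat \<lfloor>real n * t'\<rfloor>)
      \<le> last_passage w (nat \<lfloor>real n * (s + s')\<rfloor>) (nat \<lfloor>real n * (t + t')\<rfloor>)" .
    have "X s t n w + X s' t' n w2 \<le> X (s + s') (t + t') n w"
    proof -
      have "X s t n w + X s' t' n w2
        = ennreal ((last_passage w k l + last_passage w2 (nat \<lfloor>real n * s'\<rfloor>) (nat \<lfloor>real n * t'\<rfloor>)) / real n)"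
        unfolding X_def k_def l_def using lp0[OF w'] lp0[OF w2(2)] by (simp add: add_divide_distrib)
      also have "\<dots> \<le> X (s + s') (t + t') n w"
        unfolding X_def by (intro ennreal_leI divide_right_mono lp) simp
      finally show ?thesis .
    qed
    show "w \<in> A n \<union> B' \<union> C n"
    proof (rule ccontr)
      assume "w \<notin> A n \<union> B' \<union> C n"
      then have "c \<le> X s t n w" "d \<le> X s' t' n w2" "X (s + s') (t + t') n w < c + d"
        using w w2 by (auto simp: A_def B'_def B_def C_def w2_def not_le)
      with \<open>X s t n w + X s' t' n w2 \<le> _\<close> add_mono[of c "X s t n w" d "X s' t' n w2"]
      show False by (metis leD order_trans)
    qed
  qed
  then have "1 \<le> P.prob (A n \<union> B' \<union> C n)"
    using P.finite_measure_mono[of "space (annealed_law \<mu>)" "A n \<union> B' \<union> C n"] ABC B'm P.prob_space by auto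
  also have "\<dots> \<le> P.prob (A n) + P.prob B' + P.prob (C n)"
    using measure_Un_le[OF sets.Un[OF ABC(1)[of n] B'm] ABC(3)[of n]] measure_Un_le[OF ABC(1)[of n] B'm] by linarith
  finally show False using N[of n] B' by (simp add: n_def)
qed

end

section \<open>The shape function\<close>

text \<open>The form in which the right endpoint enters the lower bound: a point of the support lies above \<open>c\<close>, and its
  neighbourhood \<open>{c<..}\<close> has positive measure.\<close>

lemma right_endpoint_not_AE_le:
  assumes "right_endpoint \<eta> = 1" "sets \<eta> = sets borel" "c < 1"
  shows "\<not> (AE x in \<eta>. x \<le> c)"
proof
  assume AE: "AE x in \<eta>. x \<le> c"
  have "ereal c < (SUP x\<in>support \<eta>. ereal x)"
    using assms(1,3) by (simp add: right_endpoint_def one_ereal_def)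
  then obtain x where "x \<in> support \<eta>" "c < x"
    by (auto simp: less_SUP_iff)
  then have "0 < emeasure \<eta> {c<..}"
    by (auto simp: support_def)
  moreover have "emeasure \<eta> {x \<in> space \<eta>. c < x} = 0"
    by (rule emeasure_eq_0_AE) (use AE in \<open>simp add: not_less\<close>)
  moreover have "{x \<in> space \<eta>. c < x} = {c<..}"
    using sets_eq_imp_space_eq[OF assms(2)] by auto
  ultimately show False by simp
qed

context random_environment
begin

lemma shape_ge_row:
  assumes g: "shape_function \<mu> g" and st: "0 < s" "0 < t" and b: "right_endpoint (law_b \<mu>) = 1"
  shows "ennreal s * mean_a \<le> g s t"
  unfolding mean_a_def
proof (rule shape_ge_line[where u = "\<lambda>i \<omega>. fst \<omega> i" and v = "\<lambda>\<omega>. snd \<omega> 1" and cell = "\<lambda>i. (Suc i, 1)", OF g st st(1)])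
  fix c :: real assume c: "c < 1"
  show "\<not> (AE \<omega> in \<mu>. snd \<omega> 1 \<le> c)"
  proof -
    have "(AE x in law_b \<mu>. x \<le> c) \<longleftrightarrow> (AE \<omega> in \<mu>. snd \<omega> 1 \<le> c)"
      unfolding law_b_def case_prod_unfold by (rule AE_distr_iff[OF measurable_env(2)[OF le_refl]]) simp
    moreover have "\<not> (AE x in law_b \<mu>. x \<le> c)"
      by (rule right_endpoint_not_AE_le[OF b _ c]) (simp add: law_b_def)
    ultimately show ?thesis by simp
  qed
qed (auto simp: measurable_env env_bounds shift_apply intro!: sum_row_le_last_passage[simplified])

lemma shape_ge_column:
  assumes g: "shape_function \<mu> g" and st: "0 < s" "0 < t" and a: "right_endpoint (law_a \<mu>) = 1"
  shows "ennreal t * mean_b \<le> g s t"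
  unfolding mean_b_def
proof (rule shape_ge_line[where u = "\<lambda>i \<omega>. snd \<omega> i" and v = "\<lambda>\<omega>. fst \<omega> 1" and cell = "\<lambda>i. (1, Suc i)", OF g st st(2)])
  fix c :: real assume c: "c < 1"
  show "\<not> (AE \<omega> in \<mu>. fst \<omega> 1 \<le> c)"
  proof -
    have "(AE x in law_a \<mu>. x \<le> c) \<longleftrightarrow> (AE \<omega> in \<mu>. fst \<omega> 1 \<le> c)"
      unfolding law_a_def case_prod_unfold by (rule AE_distr_iff[OF measurable_env(1)[OF le_refl]]) simp
    moreover have "\<not> (AE x in law_a \<mu>. x \<le> c)"
      by (rule right_endpoint_not_AE_le[OF a _ c]) (simp add: law_a_def)
    ultimately show ?thesis by simp
  qed
qed (auto simp: measurable_env env_bounds shift_apply intro!: sum_column_le_last_passage[simplified])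

text \<open>Of the two pieces \<open>(cs, (1-c)t)\<close> and \<open>((1-c)s, ct)\<close> the first is crossed along a row and the second
  along a column; \<open>c\<close> then tends to \<open>1\<close>.\<close>

lemma shape_ge:
  assumes g: "shape_function \<mu> g" and st: "0 < s" "0 < t"
    and ab: "right_endpoint (law_a \<mu>) = 1" "right_endpoint (law_b \<mu>) = 1"
  shows "ennreal s * mean_a + ennreal t * mean_b \<le> g s t"
proof -
  define c where "c n = 1 - 1 / real (n + 2)" for n
  have c: "0 < c n" "c n < 1" for n by (auto simp: c_def)
  have "(\<lambda>n. 1 - 1 / real (n + 2)) \<longlonglongrightarrow> 1 - 0"
    by (intro tendsto_diff tendsto_const LIMSEQ_ignore_initial_segment lim_1_over_n)
  then have lim: "c \<longlonglongrightarrow> 1" unfolding c_def by simp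
  have "ennreal (c n * s) * mean_a + ennreal (c n * t) * mean_b \<le> g s t" for n
  proof -
    have "ennreal (c n * s) * mean_a + ennreal (c n * t) * mean_b
      \<le> g (c n * s) ((1 - c n) * t) + g ((1 - c n) * s) (c n * t)"
      using c[of n] st by (intro add_mono shape_ge_row shape_ge_column g ab) auto
    also have "\<dots> \<le> g (c n * s + (1 - c n) * s) ((1 - c n) * t + c n * t)"
      using c[of n] st by (intro shape_superadditive g) auto
    also have "\<dots> = g s t" by (simp add: algebra_simps)
    finally show ?thesis .
  qed
  moreover have "(\<lambda>n. ennreal (c n * s) * mean_a + ennreal (c n * t) * mean_b) \<longlonglongrightarrow> ennreal (1 * s) * mean_a + ennreal (1 * t) * mean_b"
    using st by (intro tendsto_add tendsto_mult_ennreal tendsto_ennrealI tendsto_mult tendsto_const lim) auto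
  ultimately show ?thesis
    using LIMSEQ_le_const2 by fastforce
qed

end

theorem theorem2p7:
  fixes \<mu> :: "((nat \<Rightarrow> real) \<times> (nat \<Rightarrow> real)) measure"
    and g :: "real \<Rightarrow> real \<Rightarrow> ennreal"
  assumes "environment \<mu>"
    and "right_endpoint (law_a \<mu>) = 1"
    and "right_endpoint (law_b \<mu>) = 1"
    and "shape_function \<mu> g"
  shows "\<forall>s>0. \<forall>t>0. g s t =
    ennreal s * (\<integral>\<^sup>+(a, b). ennreal (a 1 / (1 - a 1)) \<partial>\<mu>) +
    ennreal t * (\<integral>\<^sup>+(a, b). ennreal (b 1 / (1 - b 1)) \<partial>\<mu>)"
proof -
  interpret random_environment \<mu> by standard fact
  show ?thesis
    using shape_le[OF assms(4)] shape_ge[OF assms(4) _ _ assms(2,3)]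
    by (auto simp: mean_a_def mean_b_def case_prod_unfold intro!: antisym)
qed

end
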